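(* Let $\mu\ge0$ and $\eta>\bar\eta$, and let $R:\mathbb{R}^p\times\mathbb{R}^q\to\mathbb{R}_+\cup\{+\infty\}$ be lower semicontinuous, level compact if $\mu=0$ and 1-coercive if $\mu>0$. Then the function $$u_{\eta,\mu}(\tilde\beta,\tilde\gamma):=\min_{(\beta,\gamma)}\mathcal{L}_{\eta,\mu}((\beta,\gamma),(\tilde\beta,\tilde\gamma))$$ is continuously differentiable on $\mathbb{R}^p\times\mathbb{R}^q$ with $$\nabla u_{\eta,\mu}(\tilde\beta,\tilde\gamma)=\eta\begin{pmatrix}\tilde\beta-\hat\beta\\ \tilde\gamma-\hat\gamma\end{pmatrix},\qquad\text{where }(\hat\beta,\hat\gamma)=\mathcal{S}_{\eta,\mu}(\tilde\beta,\tilde\gamma)$$ is the unique minimizer of $(\beta,\gamma)\mapsto\mathcal{L}_{\eta,\mu}((\beta,\gamma),(\tilde\beta,\tilde\gamma))$.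
   Context: Fix integers $m,p,q\ge1$, $n_1,\dots,n_m\ge1$ and, for $i=1,\dots,m$, data $X_i\in\mathbb{R}^{n_i\times p}$, $Z_i\in\mathbb{R}^{n_i\times q}$, $Y_i\in\mathbb{R}^{n_i}$ and symmetric positive definite $\Lambda_i\in\mathbb{R}^{n_i\times n_i}$. Let $\Omega_i(\gamma):=Z_i\,\mathrm{Diag}(\gamma)Z_i^T+\Lambda_i$ and $$\mathcal{L}(\beta,\gamma):=\sum_{i=1}^m\tfrac12(Y_i-X_i\beta)^T\Omega_i(\gamma)^{-1}(Y_i-X_i\beta)+\tfrac12\ln\det\Omega_i(\gamma),\quad (\beta,\gamma)\in\mathbb{R}^p\times\mathbb{R}^q_+.$$ For $\mu>0$ let $\phi_\mu(\gamma):=-\mu\sum_{i=1}^q\ln(\gamma_i/\mu)$ if all $\gamma_i>0$ and $+\infty$ otherwise; $\phi_0$ is the indicator function of $\mathbb{R}^q_+$. Define $$\mathcal{L}_{\eta,\mu}((\beta,\gamma),(\tilde\beta,\tilde\gamma)):=\mathcal{L}(\beta,\gamma)+\phi_\mu(\gamma)+\tfrac{\eta}{2}\big(\|\beta-\tilde\beta\|^2+\|\gamma-\tilde\gamma\|^2\big),$$ equal to $+\infty$ when $\gamma\notin\mathrm{dom}\,\phi_\mu$; minimization over $(\beta,\gamma)$ is over $\mathbb{R}^p\times\mathrm{dom}\,\phi_\mu$. Let $\bar\eta:=m\max_i\tfrac12\mu_{\min}(\Lambda_i)^{-2}\sigma_{\max}(Z_i)^4$ ($\mu_{\min}$ smallest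 eigenvalue, $\sigma_{\max}$ largest singular value). For $\eta>\bar\eta$ the minimizer defining $\mathcal{S}_{\eta,\mu}$ exists and is unique. $R$ is level compact if its epigraph is closed and all sets $\{R\le\nu\}$ are bounded; $R$ is 1-coercive if $\liminf_{\|w\|\to\infty}R(w)/\|w\|>0$. *)

theory Defs
  imports
    "HOL-Analysis.Analysis"
    "Jordan_Normal_Form.Determinant"
    "Jordan_Normal_Form.Gauss_Jordan_Elimination"
    "Jordan_Normal_Form.Spectral_Radius"
begin

text \<open>
  The row dimensions n i vary with the group i, so all data matrices are dimension-indexed
  (\<^typ>\<open>real mat\<close>), while the variables live in the Euclidean spaces
  \<^typ>\<open>real ^ 'p\<close> and \<^typ>\<open>real ^ 'q\<close>. The coordinate list of an element of
  \<^typ>\<open>real ^ 'n\<close> uses the fixed bijection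
  \<^term>\<open>from_nat_into (UNIV :: 'n set)\<close> between the numbers below
  \<^term>\<open>CARD('n)\<close> and the index type.
\<close>

definition coords :: "real ^ 'n \<Rightarrow> real Matrix.vec" where
  "coords x = Matrix.vec CARD('n) (\<lambda>k. vec_nth x (from_nat_into UNIV k))"

definition Diag :: "real ^ 'n \<Rightarrow> real mat" where
  "Diag x = mat_diag CARD('n) (\<lambda>k. vec_index (coords x) k)"

definition sym_pos_def :: "nat \<Rightarrow> real mat \<Rightarrow> bool" where
  "sym_pos_def n A \<longleftrightarrow> A \<in> carrier_mat n n \<and> transpose_mat A = A \<and>
     (\<forall>v \<in> carrier_vec n. v \<noteq> 0\<^sub>v n \<longrightarrow> 0 < scalar_prod v (A *\<^sub>v v))"

definition mu_min :: "real mat \<Rightarrow> real" where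
  "mu_min A = Min (spectrum A)"

definition sigma_max :: "real mat \<Rightarrow> real" where
  "sigma_max A = sqrt (Max (spectrum (transpose_mat A * A)))"

text \<open>The inverse matrix; unspecified for singular matrices.\<close>

definition inv_mat :: "real mat \<Rightarrow> real mat" where
  "inv_mat A = the (mat_inverse A)"

definition Omega :: "real mat \<Rightarrow> real mat \<Rightarrow> real ^ 'q \<Rightarrow> real mat" where
  "Omega Z \<Lambda> \<gamma> = Z * Diag \<gamma> * transpose_mat Z + \<Lambda>"

text \<open>Only the values at \<open>\<gamma> \<ge> 0\<close> are meaningful.\<close>

definition loss ::
  "nat \<Rightarrow> (nat \<Rightarrow> real mat) \<Rightarrow> (nat \<Rightarrow> real mat) \<Rightarrow> (nat \<Rightarrow> real Matrix.vec) \<Rightarrow> (nat \<Rightarrow> real mat)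
    \<Rightarrow> (real ^ 'p) \<times> (real ^ 'q) \<Rightarrow> real" where
  "loss m X Z Y \<Lambda> = (\<lambda>(\<beta>, \<gamma>). \<Sum>i = 1..m.
     (let r = Y i - X i *\<^sub>v coords \<beta>; \<Omega> = Omega (Z i) (\<Lambda> i) \<gamma>
      in 1/2 * scalar_prod r (inv_mat \<Omega> *\<^sub>v r) + 1/2 * ln (Determinant.det \<Omega>)))"

definition barrier :: "real \<Rightarrow> real ^ 'q \<Rightarrow> ereal" where
  "barrier \<mu> \<gamma> =
     (if \<mu> = 0 then (if \<forall>i. 0 \<le> vec_nth \<gamma> i then 0 else \<infinity>)
      else (if \<forall>i. 0 < vec_nth \<gamma> i
            then ereal (- \<mu> * (\<Sum>i\<in>UNIV. ln (vec_nth \<gamma> i / \<mu>))) else \<infinity>))"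

definition effective_domain :: "('a \<Rightarrow> ereal) \<Rightarrow> 'a set" where
  "effective_domain f = {x. f x < \<infinity>}"

definition penalized_loss ::
  "nat \<Rightarrow> (nat \<Rightarrow> real mat) \<Rightarrow> (nat \<Rightarrow> real mat) \<Rightarrow> (nat \<Rightarrow> real Matrix.vec) \<Rightarrow> (nat \<Rightarrow> real mat)
    \<Rightarrow> real \<Rightarrow> real \<Rightarrow> (real ^ 'p) \<times> (real ^ 'q) \<Rightarrow> (real ^ 'p) \<times> (real ^ 'q) \<Rightarrow> ereal" where
  "penalized_loss m X Z Y \<Lambda> \<eta> \<mu> = (\<lambda>(\<beta>, \<gamma>) (\<beta>', \<gamma>').
     ereal (loss m X Z Y \<Lambda> (\<beta>, \<gamma>)) + barrier \<mu> \<gamma>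
     + ereal (\<eta> / 2 * ((norm (\<beta> - \<beta>'))\<^sup>2 + (norm (\<gamma> - \<gamma>'))\<^sup>2)))"

definition feasible :: "real \<Rightarrow> ((real ^ 'p) \<times> (real ^ 'q)) set" where
  "feasible \<mu> = UNIV \<times> effective_domain (barrier \<mu>)"

definition value_fun ::
  "nat \<Rightarrow> (nat \<Rightarrow> real mat) \<Rightarrow> (nat \<Rightarrow> real mat) \<Rightarrow> (nat \<Rightarrow> real Matrix.vec) \<Rightarrow> (nat \<Rightarrow> real mat)
    \<Rightarrow> real \<Rightarrow> real \<Rightarrow> (real ^ 'p) \<times> (real ^ 'q) \<Rightarrow> ereal" where
  "value_fun m X Z Y \<Lambda> \<eta> \<mu> w' =
     (INF w \<in> feasible \<mu>. penalized_loss m X Z Y \<Lambda> \<eta> \<mu> w w')"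

definition solution_map ::
  "nat \<Rightarrow> (nat \<Rightarrow> real mat) \<Rightarrow> (nat \<Rightarrow> real mat) \<Rightarrow> (nat \<Rightarrow> real Matrix.vec) \<Rightarrow> (nat \<Rightarrow> real mat)
    \<Rightarrow> real \<Rightarrow> real \<Rightarrow> (real ^ 'p) \<times> (real ^ 'q) \<Rightarrow> (real ^ 'p) \<times> (real ^ 'q)" where
  "solution_map m X Z Y \<Lambda> \<eta> \<mu> w' =
     arg_min_on (\<lambda>w. penalized_loss m X Z Y \<Lambda> \<eta> \<mu> w w') (feasible \<mu>)"

definition eta_bar :: "nat \<Rightarrow> (nat \<Rightarrow> real mat) \<Rightarrow> (nat \<Rightarrow> real mat) \<Rightarrow> real" where
  "eta_bar m Z \<Lambda> =
     real m * (MAX i\<in>{1..m}. 1/2 * (mu_min (\<Lambda> i)) powi (-2) * (sigma_max (Z i)) ^ 4)"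

definition lower_semicontinuous :: "('a::topological_space \<Rightarrow> ereal) \<Rightarrow> bool" where
  "lower_semicontinuous f \<longleftrightarrow> (\<forall>x. f x \<le> Liminf (at x) f)"

definition level_compact :: "('a::metric_space \<Rightarrow> ereal) \<Rightarrow> bool" where
  "level_compact f \<longleftrightarrow> closed {(x, r::real). f x \<le> ereal r} \<and>
     (\<forall>\<nu>::real. bounded {x. f x \<le> ereal \<nu>})"

definition one_coercive :: "('a::real_normed_vector \<Rightarrow> ereal) \<Rightarrow> bool" where
  "one_coercive f \<longleftrightarrow> 0 < Liminf at_infinity (\<lambda>x. f x / ereal (norm x))"

end

theory Submission
  imports Defs "Jordan_Normal_Form.Schur_Decomposition"
begin

text \<open>
  Every summand of the loss has, at each point of the feasible set, a quadratically perturbed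
  affine minorant: the quadratic term is jointly convex in \<open>(\<beta>, \<gamma>)\<close>, being a supremum of affine
  functions, and \<open>ln det \<Omega>\<close> is concave with a gradient that is Lipschitz with constant
  \<open>(\<sigma>\<^sub>m\<^sub>a\<^sub>x(Z)\<^sup>2 / \<mu>\<^sub>m\<^sub>i\<^sub>n(\<Lambda>))\<^sup>2\<close>. The barrier is convex. Hence the proximal objective is strongly convex
  with modulus \<open>\<eta> - \<eta>\<^sub>b\<^sub>a\<^sub>r\<close>, its minimizer is unique and grows quadratically, so it depends Lipschitz
  continuously on the proximal centre; freezing the minimizer then sandwiches the envelope between
  its linearization and an error of second order.
\<close>

section \<open>Minimizing functions with perturbed affine minorants\<close>

text \<open>The obstacle to plain calculus is the boundary of the feasible set: for \<mu> = 0 a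
  minimizer may have vanishing components of \<gamma>. One-sided support inequalities between points
  of the set therefore replace derivatives of the inverse and of the determinant. They add up over
  groups, hold on the boundary as well, and also give lower semicontinuity and bounds from below.
  Only \<open>ln det\<close> can destroy convexity. Its tangent inequality bounds it from above, so
  a bound from below needs control of the change of its slope, which is expressed exactly by a
  resolvent identity. The factor 1/2 in the threshold is the one in front of \<open>ln det\<close>;
  the 1/2 of the quadratic remainder is gained separately, on the segment. For \<mu> > 0 the
  feasible set is open, and existence of a minimizer rests on the barrier keeping bounded pieces of
  sublevel sets away from the boundary.\<close>

text \<open>The modulus \<open>c\<close> may have either sign: a negative one expresses strong
  convexity, so that a single notion serves the loss, the barrier and the proximal objective.
  \<open>linear\<close> suffices because linear maps are bounded in Euclidean space.\<close>

definition weakly_supported :: "'a::euclidean_space set \<Rightarrow> real \<Rightarrow> ('a \<Rightarrow> real) \<Rightarrow> bool" where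
  "weakly_supported C c f \<longleftrightarrow>
     (\<forall>x\<in>C. \<exists>l. linear l \<and> (\<forall>y\<in>C. f x + l (y - x) - c / 2 * (norm (y - x))\<^sup>2 \<le> f y))"

lemma weakly_supportedI:
  assumes "\<And>x. x \<in> C \<Longrightarrow> linear (l x)"
    and "\<And>x y. x \<in> C \<Longrightarrow> y \<in> C \<Longrightarrow> f x + l x (y - x) - c / 2 * (norm (y - x))\<^sup>2 \<le> f y"
  shows "weakly_supported C c f"
  unfolding weakly_supported_def using assms by blast

lemma weakly_supportedE:
  assumes "weakly_supported C c f" "x \<in> C"
  obtains l where "linear l"
    "\<And>y. y \<in> C \<Longrightarrow> f x + l (y - x) - c / 2 * (norm (y - x))\<^sup>2 \<le> f y"
  using assms unfolding weakly_supported_def by blast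

lemma weakly_supported_mono:
  assumes "weakly_supported C c f" "c \<le> c'"
  shows "weakly_supported C c' f"
proof -
  have "c / 2 * (norm z)\<^sup>2 \<le> c' / 2 * (norm z)\<^sup>2" for z :: 'a
    using assms(2) by (intro mult_right_mono) auto
  then show ?thesis
    using assms(1) unfolding weakly_supported_def
    by (smt (verit, best))
qed

lemma weakly_supported_subset:
  "weakly_supported C c f \<Longrightarrow> D \<subseteq> C \<Longrightarrow> weakly_supported D c f"
  unfolding weakly_supported_def by blast

lemma weakly_supported_add:
  assumes "weakly_supported C c f" "weakly_supported C d g"
  shows "weakly_supported C (c + d) (\<lambda>x. f x + g x)"
  unfolding weakly_supported_def
proof
  fix x assume x: "x \<in> C"
  obtain l where l: "linear l" "\<And>y. y \<in> C \<Longrightarrow> f x + l (y - x) - c / 2 * (norm (y - x))\<^sup>2 \<le> f y"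
    using weakly_supportedE[OF assms(1) x] by blast
  obtain k where k: "linear k" "\<And>y. y \<in> C \<Longrightarrow> g x + k (y - x) - d / 2 * (norm (y - x))\<^sup>2 \<le> g y"
    using weakly_supportedE[OF assms(2) x] by blast
  have "linear (\<lambda>h. l h + k h)"
    using l(1) k(1) by (rule linear_compose_add)
  moreover have "f x + g x + (l (y - x) + k (y - x)) - (c + d) / 2 * (norm (y - x))\<^sup>2 \<le> f y + g y"
    if "y \<in> C" for y
    using l(2)[OF that] k(2)[OF that] by (simp add: add_divide_distrib distrib_right)
  ultimately show "\<exists>l. linear l \<and> (\<forall>y\<in>C. f x + g x + l (y - x) - (c + d) / 2 * (norm (y - x))\<^sup>2 \<le> f y + g y)"
    by blast
qed

lemma weakly_supported_sum:
  assumes "finite I" "\<And>i. i \<in> I \<Longrightarrow> weakly_supported C (c i) (f i)"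
  shows "weakly_supported C (\<Sum>i\<in>I. c i) (\<lambda>x. \<Sum>i\<in>I. f i x)"
  using assms
proof (induction I rule: finite_induct)
  case empty
  show ?case
    by (rule weakly_supportedI[where l = "\<lambda>_ _. 0"]) (auto simp: linear_zero)
next
  case (insert i I)
  then show ?case by (auto intro!: weakly_supported_add)
qed

text \<open>A squared distance equals its second-order expansion, so it supports itself with modulus
  \<open>- \<eta>\<close>, with equality.\<close>

lemma weakly_supported_proximal:
  assumes "weakly_supported C c f"
  shows "weakly_supported C (c - \<eta>) (\<lambda>x. f x + \<eta> / 2 * (norm (x - w))\<^sup>2)"
proof -
  have "weakly_supported C (- \<eta>) (\<lambda>x. \<eta> / 2 * (norm (x - w))\<^sup>2)"
  proof (rule weakly_supportedI[where l = "\<lambda>x h. \<eta> * inner (x - w) h"])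
    show "linear (\<lambda>h. \<eta> * inner (x - w) h)" for x
      by (intro linearI) (auto simp: algebra_simps)
    show "\<eta> / 2 * (norm (x - w))\<^sup>2 + \<eta> * inner (x - w) (y - x) - - \<eta> / 2 * (norm (y - x))\<^sup>2
        \<le> \<eta> / 2 * (norm (y - w))\<^sup>2" for x y
    proof -
      have "(norm (y - w))\<^sup>2 = (norm (x - w))\<^sup>2 + 2 * inner (x - w) (y - x) + (norm (y - x))\<^sup>2"
        by (simp add: power2_norm_eq_inner algebra_simps inner_commute)
      then show ?thesis by (simp only:) (simp add: distrib_left)
    qed
  qed
  from weakly_supported_add[OF assms this] show ?thesis by simp
qed

text \<open>The support at the intermediate point is evaluated at both ends. In the weighted sum the
  linear terms cancel, and the quadratic ones combine by (1 - t) t^2 + t (1 - t)^2 = t (1 -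
  t).\<close>

lemma weakly_supported_segment:
  assumes f: "weakly_supported C c f" and C: "convex C" "x \<in> C" "y \<in> C" and t: "0 \<le> t" "t \<le> 1"
  shows "f ((1 - t) *\<^sub>R x + t *\<^sub>R y) \<le> (1 - t) * f x + t * f y + c / 2 * t * (1 - t) * (norm (y - x))\<^sup>2"
proof -
  define z where "z = (1 - t) *\<^sub>R x + t *\<^sub>R y"
  have "z \<in> C" unfolding z_def using C t by (simp add: convex_def)
  then obtain l where l: "linear l"
    "\<And>y. y \<in> C \<Longrightarrow> f z + l (y - z) - c / 2 * (norm (y - z))\<^sup>2 \<le> f y"
    using weakly_supportedE[OF f] by blast
  have xz: "x - z = (- t) *\<^sub>R (y - x)" and yz: "y - z = (1 - t) *\<^sub>R (y - x)"
    unfolding z_def by (simp_all add: algebra_simps)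
  define N L where "N = (norm (y - x))\<^sup>2" and "L = l (y - x)"
  have "f z - t * L - c / 2 * (t\<^sup>2 * N) \<le> f x"
    using l(2)[OF C(2)] unfolding xz linear_scale[OF l(1)] L_def N_def
    by (simp add: power_mult_distrib)
  then have 1: "(1 - t) * (f z - t * L - c / 2 * (t\<^sup>2 * N)) \<le> (1 - t) * f x"
    using t by (intro mult_left_mono) auto
  have "f z + (1 - t) * L - c / 2 * ((1 - t)\<^sup>2 * N) \<le> f y"
    using l(2)[OF C(3)] unfolding yz linear_scale[OF l(1)] L_def N_def
    by (simp add: power_mult_distrib)
  then have 2: "t * (f z + (1 - t) * L - c / 2 * ((1 - t)\<^sup>2 * N)) \<le> t * f y"
    using t by (intro mult_left_mono) auto
  have "(1 - t) * (f z - t * L - c / 2 * (t\<^sup>2 * N)) + t * (f z + (1 - t) * L - c / 2 * ((1 - t)\<^sup>2 * N))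
      = f z - c / 2 * t * (1 - t) * N"
    by (simp add: field_simps power2_eq_square)
  with 1 2 show ?thesis unfolding z_def[symmetric] N_def[symmetric] by linarith
qed

text \<open>This is lower semicontinuity on \<open>C\<close>: the minorant at the limit point is
  continuous and touches \<open>f\<close> there, so continuity of the loss never has to be
  established.\<close>

lemma weakly_supported_limit_le:
  assumes f: "weakly_supported C c f" and x: "x \<in> C" "\<And>k. X k \<in> C" "X \<longlonglongrightarrow> x"
    and r: "\<And>k. f (X k) \<le> r"
  shows "f x \<le> r"
proof -
  obtain l where l: "linear l"
    "\<And>y. y \<in> C \<Longrightarrow> f x + l (y - x) - c / 2 * (norm (y - x))\<^sup>2 \<le> f y"
    using weakly_supportedE[OF f x(1)] by blast
  have cont: "isCont l 0"
    using l(1) by (simp add: linear_continuous_at linear_conv_bounded_linear)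
  have d: "(\<lambda>k. X k - x) \<longlonglongrightarrow> 0" using x(3) by (rule LIM_zero)
  have "(\<lambda>k. l (X k - x)) \<longlonglongrightarrow> l 0"
    by (rule isCont_tendsto_compose[OF cont d])
  then have "(\<lambda>k. f x + l (X k - x) - c / 2 * (norm (X k - x))\<^sup>2) \<longlonglongrightarrow> f x + 0 - c / 2 * (norm (0::'a))\<^sup>2"
    unfolding linear_0[OF l(1)] by (intro tendsto_intros d)
  moreover have "f x + l (X k - x) - c / 2 * (norm (X k - x))\<^sup>2 \<le> r" for k
    using l(2)[OF x(2)[of k]] r[of k] by linarith
  ultimately show ?thesis
    using LIMSEQ_le_const2[of "\<lambda>k. f x + l (X k - x) - c / 2 * (norm (X k - x))\<^sup>2" "f x" r] by simp
qed

text \<open>One minorant, at any point of \<open>C\<close>, is already bounded below on a bounded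
  set. This later isolates the barrier from the loss.\<close>

lemma weakly_supported_bounded_below:
  assumes f: "weakly_supported C c f" and "C \<noteq> {}" "bounded B" "0 \<le> c"
  obtains b where "\<And>y. y \<in> C \<Longrightarrow> y \<in> B \<Longrightarrow> b \<le> f y"
proof -
  obtain x where x: "x \<in> C" using assms by auto
  obtain l where l: "linear l"
    "\<And>y. y \<in> C \<Longrightarrow> f x + l (y - x) - c / 2 * (norm (y - x))\<^sup>2 \<le> f y"
    using weakly_supportedE[OF f x] by blast
  obtain K where K: "\<And>h. norm (l h) \<le> norm h * K"
    using l(1) bounded_linear.bounded linear_conv_bounded_linear by metis
  obtain M where M: "\<And>y. y \<in> B \<Longrightarrow> norm (y - x) \<le> M"
    using \<open>bounded B\<close> bounded_any_center[of B x] by (auto simp: dist_norm norm_minus_commute)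
  have "f x - M * \<bar>K\<bar> - c / 2 * M\<^sup>2 \<le> f y" if "y \<in> C" "y \<in> B" for y
  proof -
    have n: "norm (y - x) \<le> M" using M that by auto
    have "\<bar>l (y - x)\<bar> \<le> norm (y - x) * K" using K[of "y - x"] by simp
    also have "\<dots> \<le> norm (y - x) * \<bar>K\<bar>" by (intro mult_left_mono) auto
    also have "\<dots> \<le> M * \<bar>K\<bar>" using n by (intro mult_right_mono) auto
    finally have 1: "- l (y - x) \<le> M * \<bar>K\<bar>" by linarith
    have "c / 2 * (norm (y - x))\<^sup>2 \<le> c / 2 * M\<^sup>2"
      using n \<open>0 \<le> c\<close> by (intro mult_left_mono power_mono) auto
    with 1 l(2)[OF that(1)] show ?thesis by linarith
  qed
  then show ?thesis using that by blast
qed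

section \<open>Minimizers of strongly convex functions\<close>

lemma strongly_supported_sublevel_bounded:
  assumes f: "weakly_supported C (- \<kappa>) f" and "0 < \<kappa>"
  shows "bounded {y \<in> C. f y \<le> r}" and "bdd_below (f ` C)"
proof -
  have "bounded {y \<in> C. f y \<le> r} \<and> bdd_below (f ` C)"
  proof (cases "C = {}")
    case False
    then obtain x where x: "x \<in> C" by auto
    obtain l where l: "linear l"
      "\<And>y. y \<in> C \<Longrightarrow> f x + l (y - x) - (- \<kappa>) / 2 * (norm (y - x))\<^sup>2 \<le> f y"
      using weakly_supportedE[OF f x] by blast
    obtain K where K: "\<And>h. norm (l h) \<le> norm h * K" "K \<ge> 0"
      using l(1) bounded_linear.nonneg_bounded linear_conv_bounded_linear by metis
    \<comment> \<open>Completing the square spends half of the term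
      \<open>\<kappa> / 2 * (norm (y - x))\<^sup>2\<close> on the linear part, at the price of the
      constant \<open>K\<^sup>2 / \<kappa>\<close>.\<close>
    have low: "f x - K\<^sup>2 / \<kappa> + \<kappa> / 4 * (norm (y - x))\<^sup>2 \<le> f y" if y: "y \<in> C" for y
    proof -
      have "\<bar>l (y - x)\<bar> \<le> norm (y - x) * K" using K(1)[of "y - x"] by simp
      moreover have "0 \<le> \<kappa> * (norm (y - x) / 2 - K / \<kappa>)\<^sup>2" using \<open>0 < \<kappa>\<close> by simp
      moreover have "\<kappa> * (norm (y - x) / 2 - K / \<kappa>)\<^sup>2
          = \<kappa> / 4 * (norm (y - x))\<^sup>2 - norm (y - x) * K + K\<^sup>2 / \<kappa>"
        using \<open>0 < \<kappa>\<close> by (simp add: power2_eq_square field_simps)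
      ultimately show ?thesis using l(2)[OF y] by linarith
    qed
    have "bounded {y \<in> C. f y \<le> r}"
    proof (rule boundedI)
      fix y assume "y \<in> {y \<in> C. f y \<le> r}"
      then have "\<kappa> / 4 * (norm (y - x))\<^sup>2 \<le> r - f x + K\<^sup>2 / \<kappa>" using low[of y] by auto
      then have "(norm (y - x))\<^sup>2 \<le> (r - f x + K\<^sup>2 / \<kappa>) * 4 / \<kappa>"
        using \<open>0 < \<kappa>\<close> by (simp add: field_simps)
      then have "norm (y - x) \<le> sqrt ((r - f x + K\<^sup>2 / \<kappa>) * 4 / \<kappa>)"
        by (rule real_le_rsqrt)
      then show "norm y \<le> norm x + sqrt ((r - f x + K\<^sup>2 / \<kappa>) * 4 / \<kappa>)"
        using norm_triangle_sub[of y x] by linarith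
    qed
    moreover have "f x - K\<^sup>2 / \<kappa> \<le> f y" if "y \<in> C" for y
    proof -
      have "0 \<le> \<kappa> / 4 * (norm (y - x))\<^sup>2" using \<open>0 < \<kappa>\<close> by simp
      then show ?thesis using low[OF that] by linarith
    qed
    then have "bdd_below (f ` C)" by (meson bdd_below.I2)
    ultimately show ?thesis by blast
  qed auto
  then show "bounded {y \<in> C. f y \<le> r}" "bdd_below (f ` C)" by auto
qed

text \<open>Minimality is tested at points of the segment from \<open>x\<close> to \<open>y\<close>;
  after division by \<open>t\<close>, letting \<open>t\<close> tend to 0 recovers the full constant
  \<open>\<kappa> / 2\<close>.\<close>

lemma strongly_supported_minimizer_growth:
  assumes f: "weakly_supported C (- \<kappa>) f" and C: "convex C" "x \<in> C" "y \<in> C"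
    and min: "\<And>z. z \<in> C \<Longrightarrow> f x \<le> f z"
  shows "f x + \<kappa> / 2 * (norm (y - x))\<^sup>2 \<le> f y"
proof -
  define N where "N = \<kappa> / 2 * (norm (y - x))\<^sup>2"
  have step: "f x + (1 - t) * N \<le> f y" if t: "0 < t" "t < 1" for t
  proof -
    have "f x \<le> f ((1 - t) *\<^sub>R x + t *\<^sub>R y)" using C t by (intro min) (simp add: convex_def)
    also have "\<dots> \<le> (1 - t) * f x + t * f y + (- \<kappa>) / 2 * t * (1 - t) * (norm (y - x))\<^sup>2"
      using weakly_supported_segment[OF f C(1-3)] t by simp
    finally have "t * (f x + (1 - t) * N) \<le> t * f y"
      unfolding N_def by (simp add: algebra_simps)
    then show ?thesis using t by simp
  qed
  have "((\<lambda>t. f x + (1 - t) * N) \<longlongrightarrow> f x + (1 - 0) * N) (at_right 0)"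
    by (intro tendsto_intros)
  moreover have "eventually (\<lambda>t. f x + (1 - t) * N \<le> f y) (at_right 0)"
    using step eventually_at_right_real[of 0 1] by (auto elim!: eventually_mono)
  ultimately have "f x + (1 - 0) * N \<le> f y"
    by (rule tendsto_upperbound) simp
  then show ?thesis unfolding N_def by simp
qed

text \<open>The sublevel sets at the levels infimum plus \<open>1 / Suc k\<close> are nonempty,
  compact and nested; a common point attains the infimum.\<close>

lemma strongly_supported_minimizer_exists:
  assumes f: "weakly_supported C (- \<kappa>) f" and \<kappa>: "0 < \<kappa>" and C: "C \<noteq> {}"
    and closed: "\<And>r. closed {y \<in> C. f y \<le> r}"
  shows "\<exists>x\<in>C. \<forall>y\<in>C. f x \<le> f y"
proof -
  define I where "I = Inf (f ` C)"
  define A where "A k = {y \<in> C. f y \<le> I + 1 / real (Suc k)}" for k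
  have bdd: "bdd_below (f ` C)" using strongly_supported_sublevel_bounded(2)[OF f \<kappa>] .
  have "\<Inter> (range A) \<noteq> {}"
  proof (rule compact_nest)
    show "compact (A k)" for k
      unfolding A_def compact_eq_bounded_closed
      using closed strongly_supported_sublevel_bounded(1)[OF f \<kappa>] by blast
    show "A k \<noteq> {}" for k
    proof -
      have "\<exists>v\<in>f ` C. v < I + 1 / real (Suc k)"
        unfolding I_def using C by (subst cInf_less_iff[OF _ bdd, symmetric]) auto
      then show ?thesis unfolding A_def by (auto intro: less_imp_le)
    qed
    show "A k \<subseteq> A j" if "j \<le> k" for j k
    proof -
      have "1 / real (Suc k) \<le> 1 / real (Suc j)" using that by (simp add: field_simps)
      then show ?thesis unfolding A_def by auto
    qed
  qed
  then obtain x where x: "\<And>k. x \<in> A k" by auto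
  have "f x \<le> I"
  proof (rule LIMSEQ_le_const)
    show "(\<lambda>k. I + 1 / real (Suc k)) \<longlonglongrightarrow> I"
      using tendsto_add[OF tendsto_const[of I] LIMSEQ_inverse_real_of_nat]
      by (simp add: inverse_eq_divide)
    show "\<exists>N. \<forall>n\<ge>N. f x \<le> I + 1 / real (Suc n)" using x unfolding A_def by auto
  qed
  moreover have "I \<le> f y" if "y \<in> C" for y
    unfolding I_def using that bdd by (intro cInf_lower) auto
  moreover have "x \<in> C" using x unfolding A_def by auto
  ultimately show ?thesis by (meson order_trans)
qed

section \<open>Lipschitz proximal maps and smooth envelopes\<close>

text \<open>Each growth inequality is tested at the minimizer of the other centre. In the sum the
  values of \<open>f\<close> cancel and the four squares polarize to an inner product, which
  Cauchy-Schwarz bounds; one factor \<open>norm (S a - S b)\<close> is then divided out.\<close>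

lemma proximal_map_lipschitz:
  fixes S :: "'a::real_inner \<Rightarrow> 'a"
  assumes "\<And>w. S w \<in> C"
    and growth: "\<And>w y. y \<in> C \<Longrightarrow>
      f (S w) + \<eta> / 2 * (norm (S w - w))\<^sup>2 + \<kappa> / 2 * (norm (y - S w))\<^sup>2 \<le> f y + \<eta> / 2 * (norm (y - w))\<^sup>2"
    and "0 < \<kappa>" "0 \<le> \<eta>"
  shows "norm (S a - S b) \<le> \<eta> / \<kappa> * norm (a - b)"
proof (cases "S a = S b")
  case False
  have "\<kappa> * (norm (S a - S b))\<^sup>2 \<le> \<eta> / 2 * ((norm (S b - a))\<^sup>2 - (norm (S a - a))\<^sup>2
      + (norm (S a - b))\<^sup>2 - (norm (S b - b))\<^sup>2)"
    using growth[OF assms(1)[of b], of a] growth[OF assms(1)[of a], of b]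
    by (simp add: norm_minus_commute[of "S b" "S a"] algebra_simps)
  also have "(norm (S b - a))\<^sup>2 - (norm (S a - a))\<^sup>2 + (norm (S a - b))\<^sup>2 - (norm (S b - b))\<^sup>2
      = 2 * inner (S a - S b) (a - b)"
    by (simp add: power2_norm_eq_inner algebra_simps inner_commute)
  also have "\<eta> / 2 * (2 * inner (S a - S b) (a - b)) \<le> \<eta> * (norm (S a - S b) * norm (a - b))"
    using norm_cauchy_schwarz[of "S a - S b" "a - b"] \<open>0 \<le> \<eta>\<close> by (simp add: mult_left_mono)
  finally have "norm (S a - S b) * (\<kappa> * norm (S a - S b)) \<le> norm (S a - S b) * (\<eta> * norm (a - b))"
    by (simp add: power2_eq_square mult_ac)
  then have "\<kappa> * norm (S a - S b) \<le> \<eta> * norm (a - b)"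
    using False by simp
  then show ?thesis using \<open>0 < \<kappa>\<close> by (simp add: field_simps)
qed (use assms in auto)

lemma envelope_gradient:
  fixes S :: "'a::real_inner \<Rightarrow> 'a"
  assumes S: "\<And>w. S w \<in> C"
    and min: "\<And>w y. y \<in> C \<Longrightarrow>
      f (S w) + \<eta> / 2 * (norm (S w - w))\<^sup>2 \<le> f y + \<eta> / 2 * (norm (y - w))\<^sup>2"
    and lip: "\<And>a b. norm (S a - S b) \<le> L * norm (a - b)"
    and "0 \<le> \<eta>" "0 \<le> L"
  shows "GDERIV (\<lambda>w. f (S w) + \<eta> / 2 * (norm (S w - w))\<^sup>2) w :> \<eta> *\<^sub>R (w - S w)"
proof -
  let ?e = "\<lambda>w. f (S w) + \<eta> / 2 * (norm (S w - w))\<^sup>2"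
  have expand: "(norm (s - v))\<^sup>2 = (norm (s - w))\<^sup>2 + 2 * inner (v - w) (w - s) + (norm (v - w))\<^sup>2" for s v
    by (simp add: power2_norm_eq_inner algebra_simps inner_commute)
  \<comment> \<open>The upper error is \<open>\<eta> / 2\<close> and the lower one
    \<open>\<eta> * L\<close>, both times the squared distance; \<open>\<eta> * (1 + L)\<close>
    covers both.\<close>
  have bound: "\<bar>?e v - ?e w - inner (v - w) (\<eta> *\<^sub>R (w - S w))\<bar> \<le> \<eta> * (1 + L) * (norm (v - w))\<^sup>2" for v
  proof -
    have "?e v \<le> f (S w) + \<eta> / 2 * (norm (S w - v))\<^sup>2" by (rule min[OF S])
    also have "\<dots> = ?e w + inner (v - w) (\<eta> *\<^sub>R (w - S w)) + \<eta> / 2 * (norm (v - w))\<^sup>2"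
      unfolding expand[of "S w" v] by (simp add: algebra_simps)
    finally have up: "?e v \<le> ?e w + inner (v - w) (\<eta> *\<^sub>R (w - S w)) + \<eta> / 2 * (norm (v - w))\<^sup>2" .
    have "?e w \<le> f (S v) + \<eta> / 2 * (norm (S v - w))\<^sup>2" by (rule min[OF S])
    \<comment> \<open>The expansion around \<open>w\<close> with \<open>S v\<close> frozen has the
      slope \<open>w - S v\<close>; it is split into the desired \<open>w - S w\<close> and the
      displacement \<open>S w - S v\<close>, which the Lipschitz bound makes second order.\<close>
    moreover have "?e v = f (S v) + \<eta> / 2 * (norm (S v - w))\<^sup>2 + \<eta> * inner (v - w) (w - S w)
        + \<eta> * inner (v - w) (S w - S v) + \<eta> / 2 * (norm (v - w))\<^sup>2"
      unfolding expand[of "S v" v] by (simp add: algebra_simps)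
    moreover have "\<bar>inner (v - w) (S w - S v)\<bar> \<le> L * (norm (v - w))\<^sup>2"
    proof -
      have "\<bar>inner (v - w) (S w - S v)\<bar> \<le> norm (v - w) * norm (S w - S v)"
        by (rule Cauchy_Schwarz_ineq2)
      also have "\<dots> \<le> norm (v - w) * (L * norm (w - v))"
        using lip by (intro mult_left_mono) auto
      finally show ?thesis by (simp add: power2_eq_square mult_ac norm_minus_commute)
    qed
    then have "\<bar>\<eta> * inner (v - w) (S w - S v)\<bar> \<le> \<eta> * (L * (norm (v - w))\<^sup>2)"
      using \<open>0 \<le> \<eta>\<close> by (simp add: abs_mult mult_left_mono)
    moreover have "0 \<le> \<eta> * (norm (v - w))\<^sup>2" "0 \<le> \<eta> * (L * (norm (v - w))\<^sup>2)"
      using \<open>0 \<le> \<eta>\<close> \<open>0 \<le> L\<close> by auto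
    ultimately show ?thesis using up
      by (simp add: algebra_simps)
  qed
  show ?thesis
    unfolding gderiv_def has_derivative_at_within
  proof (intro conjI)
    show "bounded_linear (\<lambda>h. inner h (\<eta> *\<^sub>R (w - S w)))" by (rule bounded_linear_inner_left)
    show "((\<lambda>v. (?e v - ?e w - inner (v - w) (\<eta> *\<^sub>R (w - S w))) /\<^sub>R norm (v - w)) \<longlongrightarrow> 0) (at w)"
    proof (rule Lim_null_comparison)
      show "eventually (\<lambda>v. norm ((?e v - ?e w - inner (v - w) (\<eta> *\<^sub>R (w - S w))) /\<^sub>R norm (v - w))
          \<le> \<eta> * (1 + L) * norm (v - w)) (at w)"
        unfolding eventually_at_filter
      proof (intro always_eventually allI impI)
        fix v assume "v \<noteq> w"
        then show "norm ((?e v - ?e w - inner (v - w) (\<eta> *\<^sub>R (w - S w))) /\<^sub>R norm (v - w))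
          \<le> \<eta> * (1 + L) * norm (v - w)"
          using bound[of v] by (simp add: divide_simps power2_eq_square mult_ac)
      qed
      have "((\<lambda>v. \<eta> * (1 + L) * norm (v - w)) \<longlongrightarrow> \<eta> * (1 + L) * norm (w - w)) (at w)"
        by (intro tendsto_intros)
      then show "((\<lambda>v. \<eta> * (1 + L) * norm (v - w)) \<longlongrightarrow> 0) (at w)" by simp
    qed
  qed
qed

section \<open>Positive definite matrices\<close>

abbreviation form :: "real mat \<Rightarrow> real Matrix.vec \<Rightarrow> real Matrix.vec \<Rightarrow> real" where
  "form A x y \<equiv> scalar_prod x (A *\<^sub>v y)"

definition psd :: "nat \<Rightarrow> real mat \<Rightarrow> bool" where
  "psd n A \<longleftrightarrow> A \<in> carrier_mat n n \<and> transpose_mat A = A \<and> (\<forall>v \<in> carrier_vec n. 0 \<le> form A v v)"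

lemma scalar_prod_self_nonneg: "0 \<le> scalar_prod x (x :: real Matrix.vec)"
  unfolding scalar_prod_def by (rule sum_nonneg) simp

lemma scalar_prod_self_pos:
  assumes "(x :: real Matrix.vec) \<in> carrier_vec n" "x \<noteq> 0\<^sub>v n"
  shows "0 < scalar_prod x x"
proof -
  obtain i where i: "i < n" "vec_index x i \<noteq> 0"
    using assms by (metis carrier_vecD eq_vecI index_zero_vec)
  have "0 < vec_index x i * vec_index x i" using i by (simp add: zero_less_mult_iff) linarith
  also have "\<dots> \<le> (\<Sum>i\<in>{0..<n}. vec_index x i * vec_index x i)"
    using i by (intro member_le_sum) auto
  finally show ?thesis unfolding scalar_prod_def using assms by auto
qed

lemma form_symmetric:
  assumes A: "A \<in> carrier_mat n n" "transpose_mat A = A" and "x \<in> carrier_vec n" "y \<in> carrier_vec n"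
  shows "form A x y = form A y x"
  using transpose_vec_mult_scalar[OF A(1) assms(4,3)] A assms
  by (metis comm_scalar_prod mult_mat_vec_carrier)

lemma form_add_smult:
  assumes A: "A \<in> carrier_mat n n" "transpose_mat A = A" and x: "x \<in> carrier_vec n" and y: "y \<in> carrier_vec n"
  shows "form A (x + s \<cdot>\<^sub>v y) (x + s \<cdot>\<^sub>v y) = form A x x + 2 * s * form A x y + s\<^sup>2 * form A y y"
proof -
  have e: "A *\<^sub>v (x + s \<cdot>\<^sub>v y) = A *\<^sub>v x + s \<cdot>\<^sub>v (A *\<^sub>v y)"
    using A x y by (simp add: mult_add_distrib_mat_vec mult_mat_vec)
  have "form A (x + s \<cdot>\<^sub>v y) (x + s \<cdot>\<^sub>v y) = form A x x + s * form A x y + s * form A y x + s\<^sup>2 * form A y y"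
    unfolding e using A x y
    by (simp add: scalar_prod_add_distrib[of _ n] add_scalar_prod_distrib[of _ n] power2_eq_square algebra_simps)
  then show ?thesis using form_symmetric[OF A x y] by simp
qed

text \<open>The discriminant argument for \<open>s\<close> mapped to the form at x + s y. Degenerate
  forms must be covered, as the Rayleigh argument applies this to a matrix with a semidefinite form,
  hence the separate case of a vanishing leading coefficient.\<close>

lemma psd_Cauchy_Schwarz:
  assumes A: "psd n A" and x: "x \<in> carrier_vec n" and y: "y \<in> carrier_vec n"
  shows "(form A x y)\<^sup>2 \<le> form A x x * form A y y"
proof -
  define q b a where "q = form A x x" and "b = form A x y" and "a = form A y y"
  have nonneg: "0 \<le> q + 2 * s * b + s\<^sup>2 * a" for s
  proof -
    have "0 \<le> form A (x + s \<cdot>\<^sub>v y) (x + s \<cdot>\<^sub>v y)" using A x y unfolding psd_def by auto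
    then show ?thesis using form_add_smult[of A n x y s] A x y unfolding psd_def q_def b_def a_def by simp
  qed
  have "0 \<le> a" "0 \<le> q" using A x y unfolding psd_def q_def a_def by auto
  have "b\<^sup>2 \<le> q * a"
  proof (cases "a = 0")
    case True
    have "b = 0"
    proof (rule ccontr)
      assume "b \<noteq> 0"
      \<comment> \<open>At this \<open>s\<close> the affine function \<open>q + 2 * s * b\<close>
        takes the value -1.\<close>
      then show False using nonneg[of "- (q + 1) / (2 * b)"] True by (simp add: field_simps)
    qed
    then show ?thesis using True by simp
  next
    case False
    then have "0 < a" using \<open>0 \<le> a\<close> by simp
    have "0 \<le> a * (q + 2 * (- b / a) * b + (- b / a)\<^sup>2 * a)"
      using nonneg[of "- b / a"] \<open>0 \<le> a\<close> by (rule_tac mult_nonneg_nonneg) auto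
    also have "\<dots> = q * a - b\<^sup>2" using False by (simp add: field_simps power2_eq_square)
    finally show ?thesis by simp
  qed
  then show ?thesis unfolding q_def b_def a_def .
qed

lemma sym_pos_def_imp_psd: "sym_pos_def n A \<Longrightarrow> psd n A"
  unfolding sym_pos_def_def psd_def
  by (metis less_eq_real_def mult_mat_vec_carrier scalar_prod_left_zero)

lemma sym_pos_def_one: "sym_pos_def n (1\<^sub>m n)"
  unfolding sym_pos_def_def using scalar_prod_self_pos by auto

lemma scalar_prod_Cauchy_Schwarz:
  assumes "(x :: real Matrix.vec) \<in> carrier_vec n" "y \<in> carrier_vec n"
  shows "(scalar_prod x y)\<^sup>2 \<le> scalar_prod x x * scalar_prod y y"
  using psd_Cauchy_Schwarz[OF sym_pos_def_imp_psd[OF sym_pos_def_one] assms] assms by simp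

lemma form_bounded:
  assumes "M \<in> carrier_mat n n"
  obtains K where "0 < K" "\<And>x. x \<in> carrier_vec n \<Longrightarrow> \<bar>form M x x\<bar> \<le> K * scalar_prod x x"
proof -
  define K where "K = (\<Sum>i\<in>{0..<n}. \<Sum>j\<in>{0..<n}. \<bar>M $$ (i, j)\<bar>)"
  have bound: "\<bar>form M x x\<bar> \<le> (K + 1) * scalar_prod x x" if x: "x \<in> carrier_vec n" for x
  proof -
    let ?N = "scalar_prod x x"
    have sq: "vec_index x i * vec_index x i \<le> ?N" if "i < n" for i
    proof -
      have "vec_index x i * vec_index x i \<le> (\<Sum>i\<in>{0..<n}. vec_index x i * vec_index x i)"
        using that by (intro member_le_sum) auto
      then show ?thesis using x unfolding scalar_prod_def by simp
    qed
    have cross: "\<bar>vec_index x i * vec_index x j\<bar> \<le> ?N" if "i < n" "j < n" for i j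
    proof -
      have "0 \<le> (\<bar>vec_index x i\<bar> - \<bar>vec_index x j\<bar>)\<^sup>2" by simp
      then have "2 * \<bar>vec_index x i * vec_index x j\<bar> \<le> vec_index x i * vec_index x i + vec_index x j * vec_index x j"
        by (simp add: power2_eq_square algebra_simps abs_mult)
      then show ?thesis using sq[OF that(1)] sq[OF that(2)] by linarith
    qed
    have "form M x x = (\<Sum>i\<in>{0..<n}. \<Sum>j\<in>{0..<n}. M $$ (i, j) * (vec_index x i * vec_index x j))"
      using assms x by (simp add: scalar_prod_def mult_mat_vec_def sum_distrib_left mult_ac)
    also have "\<bar>\<dots>\<bar> \<le> (\<Sum>i\<in>{0..<n}. \<Sum>j\<in>{0..<n}. \<bar>M $$ (i, j) * (vec_index x i * vec_index x j)\<bar>)"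
      by (rule order_trans[OF sum_abs]) (intro sum_mono sum_abs)
    also have "\<dots> \<le> (\<Sum>i\<in>{0..<n}. \<Sum>j\<in>{0..<n}. \<bar>M $$ (i, j)\<bar> * ?N)"
    proof (intro sum_mono)
      fix i j assume "i \<in> {0..<n}" "j \<in> {0..<n}"
      then have "\<bar>M $$ (i, j)\<bar> * \<bar>vec_index x i * vec_index x j\<bar> \<le> \<bar>M $$ (i, j)\<bar> * ?N"
        using cross by (intro mult_left_mono) auto
      then show "\<bar>M $$ (i, j) * (vec_index x i * vec_index x j)\<bar> \<le> \<bar>M $$ (i, j)\<bar> * ?N"
        by (simp only: abs_mult[of "M $$ (i, j)"])
    qed
    also have "\<dots> = K * ?N" unfolding K_def sum_distrib_right ..
    finally show ?thesis using scalar_prod_self_nonneg[of x] by (simp add: distrib_right)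
  qed
  \<comment> \<open>The added 1 makes the constant strictly positive, so that its reciprocal can
    serve as a gap.\<close>
  have "0 < K + 1" unfolding K_def by (simp add: add_nonneg_pos sum_nonneg)
  with bound show ?thesis using that by blast
qed

section \<open>Inverse matrices and extreme eigenvalues\<close>

lemma inv_mat_inverse:
  assumes A: "(A :: real mat) \<in> carrier_mat n n" "Determinant.det A \<noteq> 0"
  shows "inv_mat A \<in> carrier_mat n n" "A * inv_mat A = 1\<^sub>m n" "inv_mat A * A = 1\<^sub>m n"
proof -
  have "mat_inverse A \<noteq> None"
    using mat_inverse(1)[OF A(1), where b = "()"] det_non_zero_imp_unit[OF A, where b = "()"] by blast
  then show "inv_mat A \<in> carrier_mat n n" "A * inv_mat A = 1\<^sub>m n" "inv_mat A * A = 1\<^sub>m n"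
    using mat_inverse(2)[OF A(1)] unfolding inv_mat_def by auto
qed

text \<open>The infimum \<open>t\<close> of the Rayleigh quotient is an eigenvalue: otherwise \<open>A - t\<close> is invertible
  and the Cauchy--Schwarz inequality for its form bounds that form away from zero.\<close>

lemma Rayleigh_infimum_eigenvalue:
  assumes A: "A \<in> carrier_mat n n" "transpose_mat A = A" and n: "0 < n"
  obtains t where "t \<in> spectrum A" "\<And>x. x \<in> carrier_vec n \<Longrightarrow> t * scalar_prod x x \<le> form A x x"
proof -
  define Q where "Q = {form A x x / scalar_prod x x | x. x \<in> carrier_vec n \<and> x \<noteq> 0\<^sub>v n}"
  define t where "t = Inf Q"
  obtain K where K: "\<And>x. x \<in> carrier_vec n \<Longrightarrow> \<bar>form A x x\<bar> \<le> K * scalar_prod x x"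
    using form_bounded[OF A(1)] by blast
  have "unit_vec n 0 \<in> carrier_vec n" "unit_vec n 0 \<noteq> (0\<^sub>v n :: real Matrix.vec)"
    using n by (auto simp: vec_eq_iff)
  then have ne: "Q \<noteq> {}" unfolding Q_def by blast
  have bdd: "bdd_below Q"
  proof (rule bdd_belowI)
    fix z assume "z \<in> Q"
    then obtain x where x: "x \<in> carrier_vec n" "x \<noteq> 0\<^sub>v n" "z = form A x x / scalar_prod x x"
      unfolding Q_def by blast
    have "- K * scalar_prod x x \<le> form A x x" using K[OF x(1)] by simp
    then show "- K \<le> z"
      unfolding x(3) pos_le_divide_eq[OF scalar_prod_self_pos[OF x(1,2)]] .
  qed
  have low: "t * scalar_prod x x \<le> form A x x" if x: "x \<in> carrier_vec n" for x
  proof (cases "x = 0\<^sub>v n")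
    case True
    then show ?thesis using A x by (simp add: scalar_prod_left_zero[of _ n])
  next
    case False
    then have "t \<le> form A x x / scalar_prod x x"
      unfolding t_def using x bdd by (intro cInf_lower) (auto simp: Q_def)
    then show ?thesis using scalar_prod_self_pos[OF x False] by (simp add: field_simps)
  qed
  define B where "B = A + (- t) \<cdot>\<^sub>m 1\<^sub>m n"
  have B: "B \<in> carrier_mat n n" "transpose_mat B = B"
    unfolding B_def using A by (auto simp: transpose_add[of _ n n] intro!: eq_matI)
  have Bv: "B *\<^sub>v x = A *\<^sub>v x + (- t) \<cdot>\<^sub>v x" if "x \<in> carrier_vec n" for x
    unfolding B_def using A that
    by (intro eq_vecI) (auto simp: add_scalar_prod_distrib[of _ n])
  have Bform: "form B x x = form A x x - t * scalar_prod x x" if "x \<in> carrier_vec n" for x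
    unfolding Bv[OF that] using A that by (simp add: scalar_prod_add_distrib[of _ n])
  have psdB: "psd n B" unfolding psd_def using B Bform low by auto
  have "Determinant.det B = 0"
  proof (rule ccontr)
    assume det: "Determinant.det B \<noteq> 0"
    note inv = inv_mat_inverse[OF B(1) det]
    obtain K where K: "0 < K" "\<And>x. x \<in> carrier_vec n \<Longrightarrow> \<bar>form (inv_mat B) x x\<bar> \<le> K * scalar_prod x x"
      using form_bounded[OF inv(1)] by blast
    have "(t + 1 / K) * scalar_prod x x \<le> form A x x" if x: "x \<in> carrier_vec n" for x
    proof -
      \<comment> \<open>With this choice \<open>form B x y\<close> is
        \<open>scalar_prod x x\<close>, while \<open>form B y y\<close> is the form of the inverse
        at \<open>x\<close>, which is at most \<open>K\<close> times the same number.\<close>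
      define y where "y = inv_mat B *\<^sub>v x"
      have y: "y \<in> carrier_vec n" and By: "B *\<^sub>v y = x"
        unfolding y_def using inv x B by (auto simp: assoc_mult_mat_vec[symmetric, of _ n n _ n])
      define N where "N = scalar_prod x x"
      have N: "0 \<le> N" unfolding N_def by (rule scalar_prod_self_nonneg)
      have "N\<^sup>2 \<le> form B x x * form B y y"
        using psd_Cauchy_Schwarz[OF psdB x y] unfolding By N_def .
      also have "form B y y = form (inv_mat B) x x"
        unfolding By using x y by (simp add: y_def comm_scalar_prod[of _ n])
      also have "form B x x * form (inv_mat B) x x \<le> form B x x * (K * N)"
        using K(2)[OF x] psdB x unfolding N_def psd_def by (intro mult_left_mono) auto
      finally have "N * N \<le> N * (K * form B x x)" by (simp add: power2_eq_square mult_ac)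
      moreover have "0 \<le> K * form B x x" using psdB x K(1) unfolding psd_def by auto
      ultimately have "N \<le> K * form B x x"
        using N by (cases "N = 0") auto
      then show ?thesis using Bform[OF x] K(1) unfolding N_def by (simp add: field_simps)
    qed
    then have "t + 1 / K \<le> z" if "z \<in> Q" for z
      using that scalar_prod_self_pos unfolding Q_def by (force simp: field_simps)
    then have "t + 1 / K \<le> t" unfolding t_def using ne by (intro cInf_greatest) auto
    then show False using K(1) by simp
  qed
  then obtain v where v: "v \<in> carrier_vec n" "v \<noteq> 0\<^sub>v n" "B *\<^sub>v v = 0\<^sub>v n"
    using det_0_iff_vec_prod_zero[OF B(1)] by blast
  have "A *\<^sub>v v = t \<cdot>\<^sub>v v"
  proof (rule eq_vecI)
    show "dim_vec (A *\<^sub>v v) = dim_vec (t \<cdot>\<^sub>v v)" using A v by auto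
    fix i assume "i < dim_vec (t \<cdot>\<^sub>v v)"
    then have i: "i < n" using v by simp
    have "vec_index (A *\<^sub>v v + (- t) \<cdot>\<^sub>v v) i = 0" using v(3) i unfolding Bv[OF v(1)] by simp
    then show "vec_index (A *\<^sub>v v) i = vec_index (t \<cdot>\<^sub>v v) i" using A v i by simp
  qed
  then have "t \<in> spectrum A"
    using A v unfolding spectrum_def eigenvalue_def eigenvector_def by auto
  then show ?thesis using that low by blast
qed

lemma Min_spectrum_le_form:
  assumes A: "A \<in> carrier_mat n n" "transpose_mat A = A" and n: "0 < n" and x: "x \<in> carrier_vec n"
  shows "Min (spectrum A) * scalar_prod x x \<le> form A x x"
proof -
  obtain t where t: "t \<in> spectrum A" "t * scalar_prod x x \<le> form A x x"
    using Rayleigh_infimum_eigenvalue[OF A n] x by blast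
  have "Min (spectrum A) \<le> t" using t(1) card_finite_spectrum(1)[OF A(1)] by simp
  then have "Min (spectrum A) * scalar_prod x x \<le> t * scalar_prod x x"
    using scalar_prod_self_nonneg by (intro mult_right_mono) auto
  with t(2) show ?thesis by simp
qed

text \<open>The Rayleigh eigenvalue of \<open>- A\<close>, with its sign reversed, is an eigenvalue
  bounding the form from above. The eigenvector in the second claim is what later shows that the
  largest eigenvalue of \<open>Z^T Z\<close> is nonnegative.\<close>

lemma Max_spectrum_form:
  assumes A: "A \<in> carrier_mat n n" "transpose_mat A = A" and n: "0 < n"
  shows "x \<in> carrier_vec n \<Longrightarrow> form A x x \<le> Max (spectrum A) * scalar_prod x x"
    and "\<exists>v\<in>carrier_vec n. v \<noteq> 0\<^sub>v n \<and> A *\<^sub>v v = Max (spectrum A) \<cdot>\<^sub>v v"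
proof -
  have neg: "(- A) *\<^sub>v x = - (A *\<^sub>v x)" if "x \<in> carrier_vec n" for x
    using A that by (intro eq_vecI) auto
  have mA: "- A \<in> carrier_mat n n" "transpose_mat (- A) = - A" using A by (auto simp: transpose_uminus)
  obtain t where t: "t \<in> spectrum (- A)" "\<And>x. x \<in> carrier_vec n \<Longrightarrow> t * scalar_prod x x \<le> form (- A) x x"
    using Rayleigh_infimum_eigenvalue[OF mA n] by blast
  obtain v where v: "v \<in> carrier_vec n" "v \<noteq> 0\<^sub>v n" "- (A *\<^sub>v v) = t \<cdot>\<^sub>v v"
    using t(1) A neg unfolding spectrum_def eigenvalue_def eigenvector_def by auto
  have "A *\<^sub>v v = (- t) \<cdot>\<^sub>v v"
  proof (rule eq_vecI)
    show "dim_vec (A *\<^sub>v v) = dim_vec ((- t) \<cdot>\<^sub>v v)" using A v by auto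
    fix i assume "i < dim_vec ((- t) \<cdot>\<^sub>v v)"
    then have i: "i < n" using v by simp
    have "vec_index (- (A *\<^sub>v v)) i = t * vec_index v i" unfolding v(3) using v(1) i by simp
    then show "vec_index (A *\<^sub>v v) i = vec_index ((- t) \<cdot>\<^sub>v v) i" using A(1) v(1) i by simp
  qed
  then have mem: "- t \<in> spectrum A"
    using A v unfolding spectrum_def eigenvalue_def eigenvector_def by auto
  have fin: "finite (spectrum A)" using card_finite_spectrum(1)[OF A(1)] .
  show "form A x x \<le> Max (spectrum A) * scalar_prod x x" if x: "x \<in> carrier_vec n"
  proof -
    have "- t * scalar_prod x x \<le> Max (spectrum A) * scalar_prod x x"
      using mem fin scalar_prod_self_nonneg by (intro mult_right_mono) auto
    moreover have "form (- A) x x = - form A x x" unfolding neg[OF x] using A x by simp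
    ultimately show ?thesis using t(2)[OF x] by simp
  qed
  have "Max (spectrum A) \<in> spectrum A" using mem fin by (intro Max_in) auto
  then show "\<exists>v\<in>carrier_vec n. v \<noteq> 0\<^sub>v n \<and> A *\<^sub>v v = Max (spectrum A) \<cdot>\<^sub>v v"
    using A unfolding spectrum_def eigenvalue_def eigenvector_def by auto
qed

text \<open>The Rayleigh eigenvalue shows that the \<open>Min\<close> ranges over a nonempty set;
  testing positive definiteness on an eigenvector of the minimum gives its sign.\<close>

lemma mu_min_bound:
  assumes "sym_pos_def n A" "0 < n"
  shows "0 < mu_min A" and "x \<in> carrier_vec n \<Longrightarrow> mu_min A * scalar_prod x x \<le> form A x x"
proof -
  have A: "A \<in> carrier_mat n n" "transpose_mat A = A" using assms unfolding sym_pos_def_def by auto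
  show "x \<in> carrier_vec n \<Longrightarrow> mu_min A * scalar_prod x x \<le> form A x x"
    unfolding mu_min_def by (rule Min_spectrum_le_form[OF A assms(2)])
  obtain t where "t \<in> spectrum A" using Rayleigh_infimum_eigenvalue[OF A assms(2)] by blast
  then have "mu_min A \<in> spectrum A"
    unfolding mu_min_def using card_finite_spectrum(1)[OF A(1)] by (intro Min_in) auto
  then obtain v where v: "v \<in> carrier_vec n" "v \<noteq> 0\<^sub>v n" "A *\<^sub>v v = mu_min A \<cdot>\<^sub>v v"
    using A unfolding spectrum_def eigenvalue_def eigenvector_def by auto
  have "0 < form A v v" using assms v unfolding sym_pos_def_def by auto
  then have "0 < mu_min A * scalar_prod v v" using v by simp
  then show "0 < mu_min A" using scalar_prod_self_pos[OF v(1,2)] by (simp add: zero_less_mult_iff)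
qed

text \<open>Squaring undoes the \<open>sqrt\<close> in \<open>sigma_max\<close> only for a
  nonnegative radicand; the sign is read off from an eigenvector, whose form value is a squared
  length.\<close>

lemma sigma_max_bound:
  assumes Z: "Z \<in> carrier_mat n q" and "0 < q"
  shows "x \<in> carrier_vec q \<Longrightarrow> scalar_prod (Z *\<^sub>v x) (Z *\<^sub>v x) \<le> (sigma_max Z)\<^sup>2 * scalar_prod x x"
proof -
  let ?A = "transpose_mat Z * Z"
  have A: "?A \<in> carrier_mat q q" "transpose_mat ?A = ?A"
    using Z by (auto simp: transpose_mult[of _ q n])
  have form: "form ?A y y = scalar_prod (Z *\<^sub>v y) (Z *\<^sub>v y)" if y: "y \<in> carrier_vec q" for y
  proof -
    have c: "Z *\<^sub>v y \<in> carrier_vec n" using Z y by auto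
    have "?A *\<^sub>v y = transpose_mat Z *\<^sub>v (Z *\<^sub>v y)" using Z y by (simp add: assoc_mult_mat_vec[of _ q n])
    then show ?thesis
      using transpose_vec_mult_scalar[OF Z y c] Z y c
      by (simp add: comm_scalar_prod[of y q])
  qed
  obtain v where v: "v \<in> carrier_vec q" "v \<noteq> 0\<^sub>v q" "?A *\<^sub>v v = Max (spectrum ?A) \<cdot>\<^sub>v v"
    using Max_spectrum_form(2)[OF A assms(2)] by blast
  have "0 \<le> form ?A v v" unfolding form[OF v(1)] by (rule scalar_prod_self_nonneg)
  then have "0 \<le> Max (spectrum ?A)"
    unfolding v(3) using v scalar_prod_self_pos[OF v(1,2)] by (simp add: zero_le_mult_iff)
  then have "(sigma_max Z)\<^sup>2 = Max (spectrum ?A)" unfolding sigma_max_def by simp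
  then show "x \<in> carrier_vec q \<Longrightarrow> scalar_prod (Z *\<^sub>v x) (Z *\<^sub>v x) \<le> (sigma_max Z)\<^sup>2 * scalar_prod x x"
    using Max_spectrum_form(1)[OF A assms(2)] form by metis
qed

section \<open>Traces, determinants and concavity of \<open>ln det\<close>\<close>

text \<open>Polymorphic because the trace is computed after passage to complex matrices, where a
  triangular form is available.\<close>

definition mat_trace :: "'a::comm_monoid_add mat \<Rightarrow> 'a" where
  "mat_trace A = (\<Sum>i<dim_row A. A $$ (i, i))"

lemma mat_trace_comm:
  fixes A B :: "'a::comm_semiring_0 mat"
  assumes "A \<in> carrier_mat n k" "B \<in> carrier_mat k n"
  shows "mat_trace (A * B) = mat_trace (B * A)"
proof -
  have "mat_trace (A * B) = (\<Sum>i<n. \<Sum>j<k. A $$ (i, j) * B $$ (j, i))"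
    using assms unfolding mat_trace_def by (simp add: scalar_prod_def atLeast0LessThan)
  also have "\<dots> = (\<Sum>j<k. \<Sum>i<n. B $$ (j, i) * A $$ (i, j))"
    by (subst sum.swap) (simp add: mult.commute)
  also have "\<dots> = mat_trace (B * A)"
    using assms unfolding mat_trace_def by (simp add: scalar_prod_def atLeast0LessThan)
  finally show ?thesis .
qed

text \<open>\<open>M\<close> is the quotient of \<open>B\<close> by \<open>A\<close> and in general
  not symmetric, so real eigenvalues are not automatic. For an eigenvector x + i y and eigenvalue p
  + i q, put N = \<open>form A x x + form A y y\<close>. Then \<open>form B x x + form B y y\<close>
  is p N, which makes p positive, and the symmetry of \<open>B\<close> forces q N = 0.\<close>

lemma eigenvalue_quotient_pos:
  fixes a :: complex
  assumes A: "sym_pos_def n A" and B: "sym_pos_def n B" and M: "M \<in> carrier_mat n n" "A * M = B"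
    and a: "eigenvalue (map_mat complex_of_real M) a"
  shows "\<exists>r>0. a = complex_of_real r"
proof -
  define p q where "p = Re a" and "q = Im a"
  have Ac: "A \<in> carrier_mat n n" "transpose_mat A = A" and Bc: "B \<in> carrier_mat n n" "transpose_mat B = B"
    using A B unfolding sym_pos_def_def by auto
  obtain v where v: "v \<in> carrier_vec n" "v \<noteq> 0\<^sub>v n" "map_mat complex_of_real M *\<^sub>v v = a \<cdot>\<^sub>v v"
    using a M unfolding eigenvalue_def eigenvector_def by auto
  define x y where "x = map_vec Re v" and "y = map_vec Im v"
  have x: "x \<in> carrier_vec n" and y: "y \<in> carrier_vec n" unfolding x_def y_def using v by auto
  have comp: "(\<Sum>j = 0..<n. complex_of_real (M $$ (i, j)) * vec_index v j) = a * vec_index v i" if "i < n" for i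
    using arg_cong[OF v(3), of "\<lambda>w. vec_index w i"] that v(1) M(1) by (simp add: scalar_prod_def)
  have Mx: "M *\<^sub>v x = p \<cdot>\<^sub>v x + (- q) \<cdot>\<^sub>v y"
  proof (rule eq_vecI)
    fix i assume "i < dim_vec (p \<cdot>\<^sub>v x + (- q) \<cdot>\<^sub>v y)"
    then have i: "i < n" using y by simp
    show "vec_index (M *\<^sub>v x) i = vec_index (p \<cdot>\<^sub>v x + (- q) \<cdot>\<^sub>v y) i"
      using arg_cong[OF comp[OF i], of Re] i v(1) M(1) x y
      by (simp add: scalar_prod_def x_def y_def p_def q_def)
  qed (use M y in auto)
  have My: "M *\<^sub>v y = q \<cdot>\<^sub>v x + p \<cdot>\<^sub>v y"
  proof (rule eq_vecI)
    fix i assume "i < dim_vec (q \<cdot>\<^sub>v x + p \<cdot>\<^sub>v y)"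
    then have i: "i < n" using y by simp
    show "vec_index (M *\<^sub>v y) i = vec_index (q \<cdot>\<^sub>v x + p \<cdot>\<^sub>v y) i"
      using arg_cong[OF comp[OF i], of Im] i v(1) M(1) x y
      by (simp add: scalar_prod_def x_def y_def p_def q_def)
  qed (use M y in auto)
  have Bx: "B *\<^sub>v x = p \<cdot>\<^sub>v (A *\<^sub>v x) + (- q) \<cdot>\<^sub>v (A *\<^sub>v y)"
    unfolding M(2)[symmetric] assoc_mult_mat_vec[OF Ac(1) M(1) x] Mx using Ac x y
    by (simp add: mult_add_distrib_mat_vec[of _ n n] mult_mat_vec[of _ n n])
  have By: "B *\<^sub>v y = q \<cdot>\<^sub>v (A *\<^sub>v x) + p \<cdot>\<^sub>v (A *\<^sub>v y)"
    unfolding M(2)[symmetric] assoc_mult_mat_vec[OF Ac(1) M(1) y] My using Ac x y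
    by (simp add: mult_add_distrib_mat_vec[of _ n n] mult_mat_vec[of _ n n])
  have Axc: "A *\<^sub>v x \<in> carrier_vec n" "A *\<^sub>v y \<in> carrier_vec n" using Ac x y by auto
  have bil: "scalar_prod z (s \<cdot>\<^sub>v (A *\<^sub>v x) + t \<cdot>\<^sub>v (A *\<^sub>v y)) = s * form A z x + t * form A z y"
    if "z \<in> carrier_vec n" for z s t
    using that Axc by (simp add: scalar_prod_add_distrib[of _ n])
  have xy: "form A x y = form A y x" by (rule form_symmetric[OF Ac x y])
  define N where "N = form A x x + form A y y"
  have ne: "x \<noteq> 0\<^sub>v n \<or> y \<noteq> 0\<^sub>v n"
  proof (rule ccontr)
    assume "\<not> ?thesis"
    then have eq: "map_vec Re v = 0\<^sub>v n" "map_vec Im v = 0\<^sub>v n" unfolding x_def y_def by auto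
    have "v = 0\<^sub>v n"
    proof (rule eq_vecI)
      fix i assume "i < dim_vec (0\<^sub>v n :: complex Matrix.vec)"
      then show "vec_index v i = vec_index (0\<^sub>v n) i"
        using arg_cong[OF eq(1), of "\<lambda>w. vec_index w i"] arg_cong[OF eq(2), of "\<lambda>w. vec_index w i"] v(1)
        by (simp add: complex_eq_iff)
    qed (use v in auto)
    then show False using v(2) by simp
  qed
  have posN: "0 < form C x x + form C y y" if "sym_pos_def n C" for C
    using ne that sym_pos_def_imp_psd[OF that] x y unfolding sym_pos_def_def psd_def
    by (metis add_nonneg_pos add_pos_nonneg)
  have "form B x x + form B y y = p * N"
    unfolding Bx By bil[OF x] bil[OF y] N_def xy by (simp add: algebra_simps)
  then have "0 < p * N" using posN[OF B] by simp
  then have p: "0 < p" using posN[OF A] unfolding N_def by (simp add: zero_less_mult_iff)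
  have "form B x y = form B y x" by (rule form_symmetric[OF Bc x y])
  then have "q * N = 0"
    unfolding Bx By bil[OF x] bil[OF y] N_def xy by (simp add: algebra_simps)
  then have "q = 0" using posN[OF A] unfolding N_def by simp
  then show ?thesis using p unfolding p_def q_def by (intro exI[of _ "Re a"]) (simp add: complex_eq_iff)
qed

text \<open>A complex Schur form turns determinant and trace into product and sum of the diagonal,
  which consists of positive reals. The quotient is given by an equation instead of
  \<open>inv_mat\<close>, since invertibility of positive definite matrices is itself obtained from
  the case where \<open>A\<close> is the identity.\<close>

lemma det_trace_quotient:
  assumes A: "sym_pos_def n A" and B: "sym_pos_def n B" and M: "M \<in> carrier_mat n n" "A * M = B"
  obtains rs where "length rs = n" "\<And>r. r \<in> set rs \<Longrightarrow> 0 < r"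
    "Determinant.det M = prod_list rs" "mat_trace M = sum_list rs"
proof -
  let ?M = "map_mat complex_of_real M"
  have Mc: "?M \<in> carrier_mat n n" using M by simp
  obtain as where as: "char_poly ?M = (\<Prod>a\<leftarrow>as. [:- a, 1:])" "length as = n"
    using char_poly_factorized[OF Mc] by blast
  obtain C P Q where "schur_decomposition ?M as = (C, P, Q)" by (cases "schur_decomposition ?M as") auto
  then have C: "similar_mat_wit ?M C P Q" "upper_triangular C" "diag_mat C = as"
    using schur_decomposition[OF Mc as(1)] by auto
  note w = similar_mat_witD2[OF Mc C(1)]
  have "\<exists>r>0. a = complex_of_real r" if "a \<in> set as" for a
  proof (rule eigenvalue_quotient_pos[OF A B M])
    have "poly (char_poly ?M) a = 0" unfolding as(1) using that
      by (induction as) auto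
    then show "eigenvalue ?M a" using eigenvalue_root_char_poly[OF Mc] by simp
  qed
  then have real: "complex_of_real (Re a) = a" "0 < Re a" if "a \<in> set as" for a
    using that by force+
  define rs where "rs = map Re as"
  have as_rs: "as = map complex_of_real rs"
    unfolding rs_def using real by (simp add: map_idI)
  have "complex_of_real (Determinant.det M) = Determinant.det ?M"
    by (simp add: of_real_hom.hom_det)
  also have "\<dots> = Determinant.det C"
    by (rule det_similar) (use C(1) in \<open>auto simp: similar_mat_def\<close>)
  also have "\<dots> = prod_list as" using det_upper_triangular[OF C(2) w(5)] C(3) by simp
  also have "\<dots> = complex_of_real (prod_list rs)"
    unfolding as_rs by (induction rs) auto
  finally have det: "Determinant.det M = prod_list rs" by (simp only: of_real_eq_iff)
  have "complex_of_real (mat_trace M) = mat_trace ?M"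
    unfolding mat_trace_def using M by simp
  also have "\<dots> = mat_trace (P * (C * Q))"
    using w by (simp add: assoc_mult_mat[of _ n n _ n _ n])
  also have "\<dots> = mat_trace ((C * Q) * P)"
    using w by (intro mat_trace_comm[of _ n n]) auto
  also have "(C * Q) * P = C" using w by (simp add: assoc_mult_mat[of _ n n _ n _ n])
  also have "mat_trace C = sum_list (diag_mat C)"
    unfolding mat_trace_def diag_mat_def by (simp add: sum_list_sum_nth atLeast0LessThan)
  also have "\<dots> = complex_of_real (sum_list rs)"
    unfolding C(3) as_rs by (induction rs) auto
  finally have tr: "mat_trace M = sum_list rs" by (simp only: of_real_eq_iff)
  have "0 < r" if "r \<in> set rs" for r using that real unfolding rs_def by auto
  then show ?thesis using that[of rs] det tr as(2) unfolding rs_def by simp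
qed

lemma prod_list_pos: "(\<And>r. r \<in> set rs \<Longrightarrow> 0 < r) \<Longrightarrow> 0 < prod_list (rs :: real list)"
  by (induction rs) auto

lemma ln_prod_list_le:
  "(\<And>r. r \<in> set rs \<Longrightarrow> 0 < r) \<Longrightarrow> ln (prod_list rs) \<le> sum_list rs - real (length rs)"
proof (induction rs)
  case (Cons r rs)
  have "0 < r" "0 < prod_list rs" using Cons.prems prod_list_pos by auto
  then have "ln (prod_list (r # rs)) = ln r + ln (prod_list rs)" by (simp add: ln_mult_pos)
  moreover have "ln r \<le> r - 1" using \<open>0 < r\<close> by (rule ln_le_minus_one)
  ultimately show ?case using Cons by simp
qed simp

lemma sym_pos_def_det_pos:
  assumes "sym_pos_def n A"
  shows "0 < Determinant.det A"
proof -
  have A: "A \<in> carrier_mat n n" using assms unfolding sym_pos_def_def by auto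
  show ?thesis
  proof (rule det_trace_quotient[OF sym_pos_def_one assms A left_mult_one_mat[OF A]])
    fix rs :: "real list"
    assume pos: "\<And>r. r \<in> set rs \<Longrightarrow> 0 < r" and det: "Determinant.det A = prod_list rs"
    show ?thesis unfolding det by (rule prod_list_pos[OF pos])
  qed
qed

lemma sym_pos_def_inv:
  assumes "sym_pos_def n A"
  shows "inv_mat A \<in> carrier_mat n n" "A * inv_mat A = 1\<^sub>m n" "inv_mat A * A = 1\<^sub>m n"
    "transpose_mat (inv_mat A) = inv_mat A"
proof -
  have A: "A \<in> carrier_mat n n" "transpose_mat A = A" using assms unfolding sym_pos_def_def by auto
  have det: "Determinant.det A \<noteq> 0" using sym_pos_def_det_pos[OF assms] by simp
  note inv = inv_mat_inverse[OF A(1) det]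
  show "inv_mat A \<in> carrier_mat n n" "A * inv_mat A = 1\<^sub>m n" "inv_mat A * A = 1\<^sub>m n" by (fact inv)+
  let ?T = "transpose_mat (inv_mat A)"
  have T: "?T \<in> carrier_mat n n" using inv by simp
  have "?T * A = 1\<^sub>m n"
    using arg_cong[OF inv(2), of transpose_mat] transpose_mult[OF A(1) inv(1)] A(2) by simp
  then have "?T * A * inv_mat A = inv_mat A" using inv by simp
  then show "?T = inv_mat A" using inv(1,2) T A by (simp add: assoc_mult_mat[of _ n n _ n _ n])
qed

text \<open>The logarithm of the determinant of the quotient is the sum of \<open>ln r\<close> over
  its positive eigenvalues, and \<open>ln r \<le> r - 1\<close> sums to trace minus
  \<open>n\<close>. This is the tangent inequality of the concave function \<open>ln det\<close>
  without its derivative.\<close>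

lemma ln_det_tangent:
  assumes A: "sym_pos_def n A" and B: "sym_pos_def n B"
  shows "ln (Determinant.det B) \<le> ln (Determinant.det A) + mat_trace (inv_mat A * B) - real n"
proof -
  have c: "A \<in> carrier_mat n n" "B \<in> carrier_mat n n" using A B unfolding sym_pos_def_def by auto
  note inv = sym_pos_def_inv[OF A]
  have M: "inv_mat A * B \<in> carrier_mat n n" "A * (inv_mat A * B) = B"
    using c inv by (auto simp: assoc_mult_mat[symmetric, of _ n n _ n _ n])
  obtain rs where rs: "length rs = n" "\<And>r. r \<in> set rs \<Longrightarrow> 0 < r"
    "Determinant.det (inv_mat A * B) = prod_list rs" "mat_trace (inv_mat A * B) = sum_list rs"
    using det_trace_quotient[OF A B M] by blast
  have "Determinant.det B = Determinant.det A * prod_list rs"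
    using det_mult[OF c(1) M(1)] M(2) rs(3) by simp
  then have "ln (Determinant.det B) = ln (Determinant.det A) + ln (prod_list rs)"
    using ln_mult_pos[OF sym_pos_def_det_pos[OF A] prod_list_pos[of rs, OF rs(2)]] by simp
  then show ?thesis using ln_prod_list_le[of rs, OF rs(2)] rs by simp
qed

section \<open>Quantitative bounds for inverses, rows and concave paths\<close>

text \<open>With w the inverse applied to \<open>y\<close>, the value s in question is both y . w
  and the form of \<open>A\<close> at w. Hence s^2 \<le> |y|^2 |w|^2 \<le> |y|^2 s / \<nu>, and s
  cancels.\<close>

lemma inv_form_bounds:
  assumes A: "sym_pos_def n A" and y: "y \<in> carrier_vec n" and "0 < \<nu>"
    and low: "\<And>w. w \<in> carrier_vec n \<Longrightarrow> \<nu> * scalar_prod w w \<le> form A w w"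
  shows "0 \<le> form (inv_mat A) y y" "form (inv_mat A) y y \<le> scalar_prod y y / \<nu>"
proof -
  have Ac: "A \<in> carrier_mat n n" using A unfolding sym_pos_def_def by auto
  note inv = sym_pos_def_inv[OF A]
  define w where "w = inv_mat A *\<^sub>v y"
  have w: "w \<in> carrier_vec n" unfolding w_def using inv y by auto
  have Aw: "A *\<^sub>v w = y" unfolding w_def
    using inv y Ac by (simp add: assoc_mult_mat_vec[symmetric, of _ n n _ n])
  define s where "s = form (inv_mat A) y y"
  have s: "s = form A w w" unfolding Aw s_def using y w by (simp add: w_def comm_scalar_prod[of _ n])
  have s0: "0 \<le> s" unfolding s using sym_pos_def_imp_psd[OF A] w unfolding psd_def by auto
  then show "0 \<le> form (inv_mat A) y y" unfolding s_def .
  have "s\<^sup>2 \<le> scalar_prod y y * scalar_prod w w"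
    using scalar_prod_Cauchy_Schwarz[OF y w] unfolding s_def w_def .
  also have "\<dots> \<le> scalar_prod y y * (s / \<nu>)"
    using low[OF w] \<open>0 < \<nu>\<close> scalar_prod_self_nonneg[of y] unfolding s[symmetric]
    by (intro mult_left_mono) (auto simp: field_simps)
  finally have "s * s \<le> s * (scalar_prod y y / \<nu>)" by (simp add: power2_eq_square field_simps)
  then have "s \<le> scalar_prod y y / \<nu>"
    using s0 scalar_prod_self_nonneg[of y] \<open>0 < \<nu>\<close>
    by (cases "s = 0") (auto simp: mult_le_cancel_left simp del: times_divide_eq_right)
  then show "form (inv_mat A) y y \<le> scalar_prod y y / \<nu>" unfolding s_def .
qed

text \<open>Row \<open>j\<close> is g = G e for a unit vector e. Cauchy-Schwarz for the form, at e
  and g, gives |g|^4 \<le> \<kappa> * (\<kappa> |g|^2), which avoids an operator norm.\<close>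

lemma psd_row_norm_le:
  assumes G: "psd q G" and j: "j < q" and \<kappa>: "0 \<le> \<kappa>"
    and up: "\<And>x. x \<in> carrier_vec q \<Longrightarrow> form G x x \<le> \<kappa> * scalar_prod x x"
  shows "(\<Sum>k<q. (G $$ (j, k))\<^sup>2) \<le> \<kappa>\<^sup>2"
proof -
  have Gc: "G \<in> carrier_mat q q" "transpose_mat G = G" using G unfolding psd_def by auto
  define e g where "e = (unit_vec q j :: real Matrix.vec)" and "g = G *\<^sub>v e"
  have e: "e \<in> carrier_vec q" and g: "g \<in> carrier_vec q" unfolding e_def g_def using Gc by auto
  define s where "s = scalar_prod g g"
  have ee: "scalar_prod e e = 1" unfolding e_def using j by simp
  have s0: "0 \<le> s" unfolding s_def by (rule scalar_prod_self_nonneg)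
  have "form G e g = s" using form_symmetric[OF Gc e g] unfolding s_def g_def by simp
  then have "s\<^sup>2 \<le> form G e e * form G g g" using psd_Cauchy_Schwarz[OF G e g] by simp
  also have "\<dots> \<le> \<kappa> * (\<kappa> * s)"
    using up[OF e] up[OF g] G e g \<kappa> unfolding ee s_def[symmetric] psd_def
    by (intro mult_mono) auto
  finally have "s * s \<le> s * \<kappa>\<^sup>2" by (simp add: power2_eq_square mult_ac)
  then have le: "s \<le> \<kappa>\<^sup>2" using s0 by (cases "s = 0") auto
  have "vec_index g k = G $$ (j, k)" if k: "k < q" for k
  proof -
    have "vec_index g k = G $$ (k, j)" unfolding g_def e_def using Gc j k by (simp add: scalar_prod_right_unit)
    also have "\<dots> = transpose_mat G $$ (k, j)" using Gc by simp
    finally show ?thesis using Gc(1) j k by simp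
  qed
  then have "s = (\<Sum>k<q. (G $$ (j, k))\<^sup>2)"
    unfolding s_def scalar_prod_def using g by (auto simp: atLeast0LessThan power2_eq_square intro!: sum.cong)
  with le show ?thesis by simp
qed

text \<open>In Young's inequality \<open>d j\<close> is paired with row \<open>j\<close> of
  \<open>a\<close> and \<open>d k\<close> with row \<open>k\<close> of \<open>b\<close>; then only
  row sums occur, and the quadratic form of an entrywise product keeps the constant
  \<open>K\<close>, independent of \<open>q\<close>.\<close>

lemma bilinear_row_bound:
  fixes a b :: "nat \<Rightarrow> nat \<Rightarrow> real"
  assumes "\<And>j. j < q \<Longrightarrow> (\<Sum>k<q. (a j k)\<^sup>2) \<le> K" "\<And>k. k < q \<Longrightarrow> (\<Sum>j<q. (b k j)\<^sup>2) \<le> K"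
  shows "(\<Sum>j<q. \<Sum>k<q. d j * a j k * d k * b k j) \<le> K * (\<Sum>j<q. (d j)\<^sup>2)"
proof -
  have "(\<Sum>j<q. \<Sum>k<q. d j * a j k * d k * b k j)
      \<le> (\<Sum>j<q. \<Sum>k<q. (d j)\<^sup>2 * (a j k)\<^sup>2 / 2 + (d k)\<^sup>2 * (b k j)\<^sup>2 / 2)"
  proof (intro sum_mono)
    fix j k
    have "0 \<le> (d j * a j k - d k * b k j)\<^sup>2" by simp
    then show "d j * a j k * d k * b k j \<le> (d j)\<^sup>2 * (a j k)\<^sup>2 / 2 + (d k)\<^sup>2 * (b k j)\<^sup>2 / 2"
      by (simp add: power2_eq_square algebra_simps)
  qed
  also have "\<dots> = (\<Sum>j<q. (d j)\<^sup>2 * (\<Sum>k<q. (a j k)\<^sup>2)) / 2 + (\<Sum>k<q. (d k)\<^sup>2 * (\<Sum>j<q. (b k j)\<^sup>2)) / 2"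
    unfolding sum.distrib
    by (subst (2) sum.swap) (simp add: sum_distrib_left sum_divide_distrib)
  also have "\<dots> \<le> (\<Sum>j<q. (d j)\<^sup>2 * K) / 2 + (\<Sum>k<q. (d k)\<^sup>2 * K) / 2"
    using assms by (intro add_mono divide_right_mono sum_mono mult_left_mono) auto
  also have "\<dots> = K * (\<Sum>j<q. (d j)\<^sup>2)" by (simp add: sum_distrib_left mult.commute)
  finally show ?thesis .
qed

text \<open>Telescoping over \<open>N\<close> equal steps replaces integration of the slope \<open>a\<close>: it yields the
  constant \<open>K / 2\<close>, where a single step would give only \<open>K\<close>.\<close>

lemma concave_path_lower_bound:
  fixes g a :: "real \<Rightarrow> real"
  assumes tangent: "\<And>s t. \<lbrakk>0 \<le> s; s \<le> 1; 0 \<le> t; t \<le> 1\<rbrakk> \<Longrightarrow> g s \<le> g t + (s - t) * a t"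
    and slope: "\<And>t. \<lbrakk>0 \<le> t; t \<le> 1\<rbrakk> \<Longrightarrow> a 0 - K * t \<le> a t"
  shows "g 0 + a 0 - K / 2 \<le> g 1"
proof -
  \<comment> \<open>The excess \<open>K / 2 * (1 / Suc n)\<close> is the error of the Riemann sum
    over right endpoints, where the bound \<open>a 0 - K * t\<close> is smallest on each
    step.\<close>
  have step: "a 0 - K / 2 - K / 2 * (1 / real (Suc n)) \<le> g 1 - g 0" for n
  proof -
    define N where "N = real (Suc n)"
    have N: "0 < N" unfolding N_def by simp
    have S: "(\<Sum>k<Suc n. real (Suc k)) = N * (N + 1) / 2"
      unfolding N_def by (induction n) (auto simp: field_simps)
    have "a 0 - K / 2 - K / 2 * (1 / N) = N * (a 0 / N) - K / N\<^sup>2 * (N * (N + 1) / 2)"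
      using N by (simp add: field_simps power2_eq_square)
    also have "\<dots> = (\<Sum>k<Suc n. a 0 / N - K / N\<^sup>2 * real (Suc k))"
      unfolding sum_subtractf sum_distrib_left[symmetric] S by (simp add: N_def)
    also have "\<dots> = (\<Sum>k<Suc n. (a 0 - K * (real (Suc k) / N)) / N)"
      by (intro sum.cong refl) (simp add: diff_divide_distrib power2_eq_square)
    also have "(\<Sum>k<Suc n. (a 0 - K * (real (Suc k) / N)) / N) \<le> (\<Sum>k<Suc n. g (real (Suc k) / N) - g (real k / N))"
    proof (rule sum_mono)
      fix k assume "k \<in> {..<Suc n}"
      then have k: "real (Suc k) / N \<le> 1" "real k / N \<le> 1" unfolding N_def by auto
      have "(a 0 - K * (real (Suc k) / N)) / N \<le> a (real (Suc k) / N) / N"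
        using slope[of "real (Suc k) / N"] k N by (intro divide_right_mono) auto
      \<comment> \<open>The tangent is taken at the right endpoint and evaluated at the left one:
        the negative step turns an upper bound on a value into a lower bound on the
        increment.\<close>
      moreover have "real k / N - real (Suc k) / N = - (1 / N)"
        by (simp add: add_divide_distrib)
      then have "g (real k / N) \<le> g (real (Suc k) / N) + - (1 / N) * a (real (Suc k) / N)"
        using tangent[of "real k / N" "real (Suc k) / N"] k N by simp
      ultimately show "(a 0 - K * (real (Suc k) / N)) / N \<le> g (real (Suc k) / N) - g (real k / N)"
        by simp
    qed
    also have "\<dots> = g 1 - g 0"
      using sum_lessThan_telescope[of "\<lambda>k. g (real k / N)" "Suc n"] by (simp add: N_def)
    finally show ?thesis unfolding N_def .
  qed
  have "(\<lambda>n. a 0 - K / 2 - K / 2 * (1 / real (Suc n))) \<longlonglongrightarrow> a 0 - K / 2 - K / 2 * 0"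
    using LIMSEQ_inverse_real_of_nat by (intro tendsto_intros) (simp add: inverse_eq_divide)
  then have "a 0 - K / 2 - K / 2 * 0 \<le> g 1 - g 0"
    by (rule LIMSEQ_le_const2) (use step in blast)
  then show ?thesis by simp
qed

section \<open>Weak convexity of the loss\<close>

lemma coords_carrier [simp]: "coords (x :: real ^ 'n) \<in> carrier_vec CARD('n)"
  unfolding coords_def by simp

lemma coords_index: "k < CARD('n) \<Longrightarrow> vec_index (coords (x :: real ^ 'n)) k = vec_nth x (from_nat_into UNIV k)"
  unfolding coords_def by simp

lemma coords_add: "coords (x + y) = coords x + coords y"
  unfolding coords_def by (intro eq_vecI) auto

lemma coords_scaleR: "coords (c *\<^sub>R x) = c \<cdot>\<^sub>v coords x"
  unfolding coords_def by (intro eq_vecI) auto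

lemma sum_coords_index:
  "(\<Sum>k<CARD('n). f (from_nat_into (UNIV :: 'n::finite set) k)) = (\<Sum>i\<in>UNIV. f i)"
  using sum.reindex_bij_betw[OF bij_betw_from_nat_into_finite[of "UNIV :: 'n set"], of f] by simp

lemma sum_coords_square:
  "(\<Sum>k<CARD('n). (vec_index (coords (x :: real ^ 'n)) k)\<^sup>2) = (norm x)\<^sup>2"
proof -
  have "(\<Sum>k<CARD('n). (vec_index (coords x) k)\<^sup>2) = (\<Sum>i\<in>UNIV. (vec_nth x i)\<^sup>2)"
    by (subst sum_coords_index[symmetric]) (simp add: coords_index)
  then show ?thesis unfolding power2_norm_eq_inner inner_vec_def by (simp add: power2_eq_square)
qed

lemma linear_scalar_prod_coords:
  fixes X :: "real mat"
  assumes X: "X \<in> carrier_mat n CARD('p)" and z: "z \<in> carrier_vec n"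
  shows "linear (\<lambda>h :: real ^ 'p. scalar_prod z (X *\<^sub>v coords h))"
proof (rule linearI)
  fix a b :: "real ^ 'p" and c :: real
  have car: "X *\<^sub>v coords h \<in> carrier_vec n" for h :: "real ^ 'p" using X by auto
  show "scalar_prod z (X *\<^sub>v coords (a + b)) = scalar_prod z (X *\<^sub>v coords a) + scalar_prod z (X *\<^sub>v coords b)"
    unfolding coords_add mult_add_distrib_mat_vec[OF X coords_carrier coords_carrier]
    by (rule scalar_prod_add_distrib[OF z car car])
  show "scalar_prod z (X *\<^sub>v coords (c *\<^sub>R a)) = c *\<^sub>R scalar_prod z (X *\<^sub>v coords a)"
    unfolding coords_scaleR mult_mat_vec[OF X coords_carrier] using z car by simp
qed

lemma linear_sum_coords:
  "linear (\<lambda>h :: real ^ 'q. \<Sum>j<CARD('q). vec_index (coords h) j * c j)"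
  by (rule linearI)
    (simp_all add: coords_index sum.distrib distrib_right sum_distrib_left mult.assoc)

lemma Diag_carrier [simp]: "Diag (\<gamma> :: real ^ 'q) \<in> carrier_mat CARD('q) CARD('q)"
  unfolding Diag_def by simp

lemma Diag_index: "\<lbrakk>j < CARD('q); k < CARD('q)\<rbrakk> \<Longrightarrow>
    Diag (\<gamma> :: real ^ 'q) $$ (j, k) = (if j = k then vec_index (coords \<gamma>) k else 0)"
  unfolding Diag_def mat_diag_def by simp

lemma form_Diag:
  assumes "u \<in> carrier_vec CARD('q)"
  shows "form (Diag (\<gamma> :: real ^ 'q)) u u = (\<Sum>j<CARD('q). vec_index (coords \<gamma>) j * (vec_index u j)\<^sup>2)"
proof -
  have "vec_index (Diag \<gamma> *\<^sub>v u) j = vec_index (coords \<gamma>) j * vec_index u j" if j: "j < CARD('q)" for j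
  proof -
    have "vec_index (Diag \<gamma> *\<^sub>v u) j = (\<Sum>k\<in>{0..<CARD('q)}. Diag \<gamma> $$ (j, k) * vec_index u k)"
      using assms j carrier_matD[OF Diag_carrier[of \<gamma>]] by (simp add: scalar_prod_def)
    also have "\<dots> = (\<Sum>k\<in>{0..<CARD('q)}. if j = k then vec_index (coords \<gamma>) k * vec_index u k else 0)"
      using j by (intro sum.cong) (auto simp: Diag_index)
    finally show ?thesis using j by simp
  qed
  then show ?thesis
    using carrier_matD[OF Diag_carrier[of \<gamma>]]
    unfolding scalar_prod_def atLeast0LessThan dim_mult_mat_vec
    by (auto simp: power2_eq_square mult_ac intro!: sum.cong)
qed

lemma Diag_add: "Diag (\<gamma> + \<delta>) = Diag \<gamma> + Diag (\<delta> :: real ^ 'q)"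
  using carrier_matD[OF Diag_carrier[of \<gamma>]] carrier_matD[OF Diag_carrier[of \<delta>]]
    carrier_matD[OF Diag_carrier[of "\<gamma> + \<delta>"]]
  by (intro eq_matI) (auto simp: Diag_index coords_index)

lemma Diag_transpose: "transpose_mat (Diag (\<gamma> :: real ^ 'q)) = Diag \<gamma>"
  using carrier_matD[OF Diag_carrier[of \<gamma>]]
  by (intro eq_matI) (auto simp: Diag_index)

lemma Omega_carrier:
  assumes "Z \<in> carrier_mat n CARD('q)" "\<Lambda> \<in> carrier_mat n n"
  shows "Omega Z \<Lambda> (\<gamma> :: real ^ 'q) \<in> carrier_mat n n"
  using assms unfolding Omega_def by simp

lemma Omega_shift:
  assumes Z: "Z \<in> carrier_mat n CARD('q)" and L: "\<Lambda> \<in> carrier_mat n n"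
  shows "Omega Z \<Lambda> (\<gamma>' :: real ^ 'q) = Omega Z \<Lambda> \<gamma> + Z * Diag (\<gamma>' - \<gamma>) * transpose_mat Z"
proof -
  let ?T = "transpose_mat Z" and ?D = "Diag (\<gamma>' - \<gamma>)"
  have T: "?T \<in> carrier_mat CARD('q) n" using Z by simp
  have "Diag \<gamma>' = Diag \<gamma> + ?D" using Diag_add[of \<gamma> "\<gamma>' - \<gamma>"] by simp
  then have "Z * Diag \<gamma>' * ?T = Z * Diag \<gamma> * ?T + Z * ?D * ?T"
    using mult_add_distrib_mat[OF Z Diag_carrier[of \<gamma>] Diag_carrier[of "\<gamma>' - \<gamma>"]]
      add_mult_distrib_mat[OF mult_carrier_mat[OF Z Diag_carrier[of \<gamma>]]
        mult_carrier_mat[OF Z Diag_carrier[of "\<gamma>' - \<gamma>"]] T] by simp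
  moreover have "Z * Diag \<gamma> * ?T \<in> carrier_mat n n" "Z * ?D * ?T \<in> carrier_mat n n"
    by (rule mult_carrier_mat[OF mult_carrier_mat[OF Z Diag_carrier] T])+
  ultimately show ?thesis unfolding Omega_def using L
    by (simp add: assoc_add_mat[of _ n n] comm_add_mat[of _ n n])
qed

lemma form_conjugate:
  assumes Z: "Z \<in> carrier_mat n q" and D: "D \<in> carrier_mat q q" and x: "x \<in> carrier_vec n"
  shows "form (Z * D * transpose_mat Z) x x = form D (transpose_mat Z *\<^sub>v x) (transpose_mat Z *\<^sub>v x)"
proof -
  let ?T = "transpose_mat Z"
  have T: "?T \<in> carrier_mat q n" using Z by simp
  have u: "?T *\<^sub>v x \<in> carrier_vec q" and Du: "D *\<^sub>v (?T *\<^sub>v x) \<in> carrier_vec q" using T D x by auto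
  have "Z * D * ?T *\<^sub>v x = Z *\<^sub>v (D *\<^sub>v (?T *\<^sub>v x))"
    using assoc_mult_mat_vec[OF mult_carrier_mat[OF Z D] T x] assoc_mult_mat_vec[OF Z D u] by simp
  then show ?thesis using transpose_vec_mult_scalar[OF Z Du x] by simp
qed

text \<open>For fixed \<open>x\<close> the form is affine in \<gamma>, which makes the variational
  formula for the quadratic term jointly affine; the squared coefficients give monotonicity in
  \<gamma>.\<close>

lemma Omega_form:
  assumes Z: "Z \<in> carrier_mat n CARD('q)" and L: "\<Lambda> \<in> carrier_mat n n" and x: "x \<in> carrier_vec n"
  shows "form (Omega Z \<Lambda> (\<gamma> :: real ^ 'q)) x x
    = (\<Sum>j<CARD('q). vec_index (coords \<gamma>) j * (vec_index (transpose_mat Z *\<^sub>v x) j)\<^sup>2) + form \<Lambda> x x"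
proof -
  let ?W = "Z * Diag \<gamma> * transpose_mat Z"
  have W: "?W \<in> carrier_mat n n"
    using mult_carrier_mat[OF mult_carrier_mat[OF Z Diag_carrier[of \<gamma>]], of "transpose_mat Z" n] Z by simp
  have "form (Omega Z \<Lambda> \<gamma>) x x = form ?W x x + form \<Lambda> x x"
    unfolding Omega_def add_mult_distrib_mat_vec[OF W L x]
    by (rule scalar_prod_add_distrib[OF x mult_mat_vec_carrier[OF W x] mult_mat_vec_carrier[OF L x]])
  also have "form ?W x x = (\<Sum>j<CARD('q). vec_index (coords \<gamma>) j * (vec_index (transpose_mat Z *\<^sub>v x) j)\<^sup>2)"
    unfolding form_conjugate[OF Z Diag_carrier x] using Z x by (intro form_Diag) auto
  finally show ?thesis .
qed

lemma Omega_form_ge: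
  assumes "Z \<in> carrier_mat n CARD('q)" "\<Lambda> \<in> carrier_mat n n" "x \<in> carrier_vec n"
    and "\<forall>i. 0 \<le> vec_nth (\<gamma> :: real ^ 'q) i"
  shows "form \<Lambda> x x \<le> form (Omega Z \<Lambda> \<gamma>) x x"
  unfolding Omega_form[OF assms(1-3)] using assms(4) by (simp add: coords_index sum_nonneg)

lemma Omega_sym_pos_def:
  assumes Z: "Z \<in> carrier_mat n CARD('q)" and L: "sym_pos_def n \<Lambda>"
    and \<gamma>: "\<forall>i. 0 \<le> vec_nth (\<gamma> :: real ^ 'q) i"
  shows "sym_pos_def n (Omega Z \<Lambda> \<gamma>)"
  unfolding sym_pos_def_def
proof (intro conjI ballI impI)
  have Lc: "\<Lambda> \<in> carrier_mat n n" "transpose_mat \<Lambda> = \<Lambda>" using L unfolding sym_pos_def_def by auto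
  show "Omega Z \<Lambda> \<gamma> \<in> carrier_mat n n" by (rule Omega_carrier[OF Z Lc(1)])
  let ?T = "transpose_mat Z"
  have T: "?T \<in> carrier_mat CARD('q) n" using Z by simp
  have ZD: "Z * Diag \<gamma> \<in> carrier_mat n CARD('q)" using Z by simp
  have "transpose_mat (Z * Diag \<gamma> * ?T) = Z * (Diag \<gamma> * ?T)"
    unfolding transpose_mult[OF ZD T] transpose_mult[OF Z Diag_carrier] Diag_transpose by simp
  also have "\<dots> = Z * Diag \<gamma> * ?T" by (rule assoc_mult_mat[OF Z Diag_carrier T, symmetric])
  finally show "transpose_mat (Omega Z \<Lambda> \<gamma>) = Omega Z \<Lambda> \<gamma>"
    unfolding Omega_def using transpose_add[OF mult_carrier_mat[OF ZD T] Lc(1)] Lc(2) by simp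
  fix v :: "real Matrix.vec" assume v: "v \<in> carrier_vec n" "v \<noteq> 0\<^sub>v n"
  have "0 < form \<Lambda> v v" using L v unfolding sym_pos_def_def by auto
  then show "0 < form (Omega Z \<Lambda> \<gamma>) v v" using Omega_form_ge[OF Z Lc(1) v(1) \<gamma>] by linarith
qed

section \<open>Curvature of \<open>ln det\<close> in \<gamma>\<close>

text \<open>For nonnegative \<gamma> its diagonal is the slope of \<open>ln det\<close> in \<gamma>;
  the negated squares of its entries are the second derivatives.\<close>

definition gram :: "real mat \<Rightarrow> real mat \<Rightarrow> real ^ 'q \<Rightarrow> real mat" where
  "gram Z \<Lambda> \<gamma> = transpose_mat Z * inv_mat (Omega Z \<Lambda> \<gamma>) * Z"

text \<open>The form at \<open>x\<close> is that of the inverse at Z x. As \<open>Omega\<close>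
  dominates \<Lambda>, it is at most |Z x|^2 / \<open>mu_min \<Lambda>\<close>; the length of Z x
  then contributes the squared singular value.\<close>

lemma gram_bounds:
  assumes Z: "Z \<in> carrier_mat n CARD('q)" and L: "sym_pos_def n \<Lambda>" and n: "0 < n"
    and \<gamma>: "\<forall>i. 0 \<le> vec_nth (\<gamma> :: real ^ 'q) i"
  shows "psd CARD('q) (gram Z \<Lambda> \<gamma>)"
    and "x \<in> carrier_vec CARD('q) \<Longrightarrow>
      form (gram Z \<Lambda> \<gamma>) x x \<le> (sigma_max Z)\<^sup>2 / mu_min \<Lambda> * scalar_prod x x"
proof -
  let ?T = "transpose_mat Z" and ?I = "inv_mat (Omega Z \<Lambda> \<gamma>)"
  have Lc: "\<Lambda> \<in> carrier_mat n n" using L unfolding sym_pos_def_def by auto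
  have spd: "sym_pos_def n (Omega Z \<Lambda> \<gamma>)" by (rule Omega_sym_pos_def[OF Z L \<gamma>])
  note inv = sym_pos_def_inv[OF spd]
  have T: "?T \<in> carrier_mat CARD('q) n" using Z by simp
  have low: "mu_min \<Lambda> * scalar_prod w w \<le> form (Omega Z \<Lambda> \<gamma>) w w" if w: "w \<in> carrier_vec n" for w
    using mu_min_bound(2)[OF L n w] Omega_form_ge[OF Z Lc w \<gamma>] by linarith
  have Zx: "Z *\<^sub>v x \<in> carrier_vec n" if "x \<in> carrier_vec CARD('q)" for x using Z that by auto
  have form: "form (gram Z \<Lambda> \<gamma>) x x = form ?I (Z *\<^sub>v x) (Z *\<^sub>v x)" if x: "x \<in> carrier_vec CARD('q)" for x
    unfolding gram_def using form_conjugate[OF T inv(1) x] by simp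
  note bounds = inv_form_bounds[OF spd Zx mu_min_bound(1)[OF L n] low]
  have car: "gram Z \<Lambda> \<gamma> \<in> carrier_mat CARD('q) CARD('q)" unfolding gram_def using Z T inv by auto
  have "transpose_mat (gram Z \<Lambda> \<gamma>) = ?T * (?I * Z)"
    unfolding gram_def transpose_mult[OF mult_carrier_mat[OF T inv(1)] Z] transpose_mult[OF T inv(1)] inv(4)
    by simp
  also have "\<dots> = gram Z \<Lambda> \<gamma>" unfolding gram_def by (rule assoc_mult_mat[OF T inv(1) Z, symmetric])
  finally show "psd CARD('q) (gram Z \<Lambda> \<gamma>)"
    unfolding psd_def using car form bounds(1) by simp
  show "form (gram Z \<Lambda> \<gamma>) x x \<le> (sigma_max Z)\<^sup>2 / mu_min \<Lambda> * scalar_prod x x"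
    if x: "x \<in> carrier_vec CARD('q)"
  proof -
    have "form (gram Z \<Lambda> \<gamma>) x x \<le> scalar_prod (Z *\<^sub>v x) (Z *\<^sub>v x) / mu_min \<Lambda>"
      unfolding form[OF x] by (rule bounds(2)[OF x])
    also have "\<dots> \<le> (sigma_max Z)\<^sup>2 * scalar_prod x x / mu_min \<Lambda>"
      using sigma_max_bound[OF Z _ x] mu_min_bound(1)[OF L n] by (intro divide_right_mono) auto
    finally show ?thesis by simp
  qed
qed

text \<open>Cyclicity of the trace moves \<open>Z^T\<close> to the front, so that the increment
  becomes the trace of \<open>gram\<close> times a diagonal matrix and only the diagonal of
  \<open>gram\<close> survives.\<close>

lemma ln_det_Omega_tangent:
  assumes Z: "Z \<in> carrier_mat n CARD('q)" and L: "sym_pos_def n \<Lambda>"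
    and \<gamma>: "\<forall>i. 0 \<le> vec_nth (\<gamma> :: real ^ 'q) i" and \<gamma>': "\<forall>i. 0 \<le> vec_nth \<gamma>' i"
  shows "ln (Determinant.det (Omega Z \<Lambda> \<gamma>')) \<le> ln (Determinant.det (Omega Z \<Lambda> \<gamma>))
      + (\<Sum>j<CARD('q). vec_index (coords (\<gamma>' - \<gamma>)) j * gram Z \<Lambda> \<gamma> $$ (j, j))"
proof -
  let ?T = "transpose_mat Z" and ?I = "inv_mat (Omega Z \<Lambda> \<gamma>)" and ?D = "Diag (\<gamma>' - \<gamma>)"
  have Lc: "\<Lambda> \<in> carrier_mat n n" using L unfolding sym_pos_def_def by auto
  have spd: "sym_pos_def n (Omega Z \<Lambda> \<gamma>)" "sym_pos_def n (Omega Z \<Lambda> \<gamma>')"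
    using Omega_sym_pos_def[OF Z L] \<gamma> \<gamma>' by auto
  note inv = sym_pos_def_inv[OF spd(1)]
  have T: "?T \<in> carrier_mat CARD('q) n" using Z by simp
  have ZD: "Z * ?D \<in> carrier_mat n CARD('q)" using Z by simp
  have IZD: "?I * (Z * ?D) \<in> carrier_mat n CARD('q)" using inv ZD by simp
  have W: "Z * ?D * ?T \<in> carrier_mat n n" by (rule mult_carrier_mat[OF ZD T])
  have G: "gram Z \<Lambda> \<gamma> \<in> carrier_mat CARD('q) CARD('q)" unfolding gram_def using Z T inv by auto
  have "?I * Omega Z \<Lambda> \<gamma>' = 1\<^sub>m n + ?I * (Z * ?D * ?T)"
    unfolding Omega_shift[OF Z Lc, of \<gamma>' \<gamma>] using mult_add_distrib_mat[OF inv(1) Omega_carrier[OF Z Lc] W] inv(3)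
    by simp
  moreover have "?I * (Z * ?D * ?T) \<in> carrier_mat n n" using inv W by auto
  ultimately have "mat_trace (?I * Omega Z \<Lambda> \<gamma>') = real n + mat_trace (?I * (Z * ?D * ?T))"
    unfolding mat_trace_def by (simp add: sum.distrib del: index_mult_mat)
  also have "?I * (Z * ?D * ?T) = ?I * (Z * ?D) * ?T"
    by (rule assoc_mult_mat[OF inv(1) ZD T, symmetric])
  also have "mat_trace \<dots> = mat_trace (?T * (?I * (Z * ?D)))"
    by (rule mat_trace_comm[OF IZD T])
  also have "?T * (?I * (Z * ?D)) = gram Z \<Lambda> \<gamma> * ?D"
    unfolding gram_def using assoc_mult_mat[OF T inv(1) ZD]
      assoc_mult_mat[OF mult_carrier_mat[OF T inv(1)] Z Diag_carrier[of "\<gamma>' - \<gamma>"]] by simp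
  also have "mat_trace (gram Z \<Lambda> \<gamma> * ?D) = (\<Sum>j<CARD('q). vec_index (coords (\<gamma>' - \<gamma>)) j * gram Z \<Lambda> \<gamma> $$ (j, j))"
    unfolding Diag_def mat_diag_mult_right[OF G] mat_trace_def by (simp add: mult.commute)
  finally show ?thesis using ln_det_tangent[OF spd] by simp
qed

text \<open>The second resolvent identity for the two inverses, conjugated by \<open>Z\<close>. It
  is an exact difference formula and stands in for the derivative of the inverse.\<close>

lemma gram_resolvent:
  assumes Z: "Z \<in> carrier_mat n CARD('q)" and L: "sym_pos_def n \<Lambda>"
    and \<gamma>: "\<forall>i. 0 \<le> vec_nth (\<gamma> :: real ^ 'q) i" and \<gamma>': "\<forall>i. 0 \<le> vec_nth \<gamma>' i"
  shows "gram Z \<Lambda> \<gamma> = gram Z \<Lambda> \<gamma>' + gram Z \<Lambda> \<gamma> * Diag (\<gamma>' - \<gamma>) * gram Z \<Lambda> \<gamma>'"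
proof -
  let ?T = "transpose_mat Z" and ?D = "Diag (\<gamma>' - \<gamma>)"
  let ?I = "inv_mat (Omega Z \<Lambda> \<gamma>)" and ?J = "inv_mat (Omega Z \<Lambda> \<gamma>')"
  have Lc: "\<Lambda> \<in> carrier_mat n n" using L unfolding sym_pos_def_def by auto
  note I = sym_pos_def_inv[OF Omega_sym_pos_def[OF Z L \<gamma>]]
  note J = sym_pos_def_inv[OF Omega_sym_pos_def[OF Z L \<gamma>']]
  have T: "?T \<in> carrier_mat CARD('q) n" using Z by simp
  have D: "?D \<in> carrier_mat CARD('q) CARD('q)" by simp
  have W: "Z * ?D * ?T \<in> carrier_mat n n" by (rule mult_carrier_mat[OF mult_carrier_mat[OF Z D] T])
  have IW: "?I * (Z * ?D * ?T) \<in> carrier_mat n n" and IWJ: "?I * (Z * ?D * ?T) * ?J \<in> carrier_mat n n"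
    using I J W by auto
  have "?I = ?I * (Omega Z \<Lambda> \<gamma>' * ?J)" using I J by simp
  also have "\<dots> = ?I * Omega Z \<Lambda> \<gamma>' * ?J"
    by (rule assoc_mult_mat[OF I(1) Omega_carrier[OF Z Lc] J(1), symmetric])
  also have "?I * Omega Z \<Lambda> \<gamma>' = 1\<^sub>m n + ?I * (Z * ?D * ?T)"
    unfolding Omega_shift[OF Z Lc, of \<gamma>' \<gamma>] using mult_add_distrib_mat[OF I(1) Omega_carrier[OF Z Lc] W] I(3)
    by simp
  also have "(1\<^sub>m n + ?I * (Z * ?D * ?T)) * ?J = ?J + ?I * (Z * ?D * ?T) * ?J"
    using add_mult_distrib_mat[OF one_carrier_mat IW J(1)] J(1) by simp
  finally have eq: "?I = ?J + ?I * (Z * ?D * ?T) * ?J" .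
  have "gram Z \<Lambda> \<gamma> = ?T * (?J + ?I * (Z * ?D * ?T) * ?J) * Z"
    unfolding gram_def by (subst eq) simp
  also have "\<dots> = gram Z \<Lambda> \<gamma>' + ?T * (?I * (Z * ?D * ?T) * ?J) * Z"
    unfolding gram_def mult_add_distrib_mat[OF T J(1) IWJ]
    by (rule add_mult_distrib_mat[OF mult_carrier_mat[OF T J(1)] mult_carrier_mat[OF T IWJ] Z])
  also have "?T * (?I * (Z * ?D * ?T) * ?J) * Z = gram Z \<Lambda> \<gamma> * ?D * gram Z \<Lambda> \<gamma>'"
  proof -
    have JZ: "?J * Z \<in> carrier_mat n CARD('q)" by (rule mult_carrier_mat[OF J(1) Z])
    have TJZ: "?T * (?J * Z) \<in> carrier_mat CARD('q) CARD('q)" by (rule mult_carrier_mat[OF T JZ])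
    have DTJZ: "?D * (?T * (?J * Z)) \<in> carrier_mat CARD('q) CARD('q)" by (rule mult_carrier_mat[OF D TJZ])
    have ZDTJZ: "Z * (?D * (?T * (?J * Z))) \<in> carrier_mat n CARD('q)" by (rule mult_carrier_mat[OF Z DTJZ])
    have TI: "?T * ?I \<in> carrier_mat CARD('q) n" by (rule mult_carrier_mat[OF T I(1)])
    have TIZ: "?T * ?I * Z \<in> carrier_mat CARD('q) CARD('q)" by (rule mult_carrier_mat[OF TI Z])
    have "?T * (?I * (Z * ?D * ?T) * ?J) * Z = ?T * (?I * (Z * (?D * (?T * (?J * Z)))))"
    proof -
      have "?T * (?I * (Z * ?D * ?T) * ?J) * Z = ?T * ((?I * (Z * ?D * ?T) * ?J) * Z)"
        by (rule assoc_mult_mat[OF T IWJ Z])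
      also have "(?I * (Z * ?D * ?T) * ?J) * Z = ?I * (Z * ?D * ?T) * (?J * Z)"
        by (rule assoc_mult_mat[OF IW J(1) Z])
      also have "\<dots> = ?I * (Z * ?D * ?T * (?J * Z))"
        by (rule assoc_mult_mat[OF I(1) W JZ])
      also have "Z * ?D * ?T * (?J * Z) = Z * ?D * (?T * (?J * Z))"
        by (rule assoc_mult_mat[OF mult_carrier_mat[OF Z D] T JZ])
      also have "\<dots> = Z * (?D * (?T * (?J * Z)))"
        by (rule assoc_mult_mat[OF Z D TJZ])
      finally show ?thesis .
    qed
    also have "\<dots> = ?T * ?I * (Z * (?D * (?T * (?J * Z))))"
      by (rule assoc_mult_mat[OF T I(1) ZDTJZ, symmetric])
    also have "\<dots> = ?T * ?I * Z * (?D * (?T * (?J * Z)))"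
      by (rule assoc_mult_mat[OF TI Z DTJZ, symmetric])
    also have "\<dots> = ?T * ?I * Z * ?D * (?T * (?J * Z))"
      by (rule assoc_mult_mat[OF TIZ D TJZ, symmetric])
    also have "?T * (?J * Z) = ?T * ?J * Z"
      by (rule assoc_mult_mat[OF T J(1) Z, symmetric])
    finally show ?thesis unfolding gram_def .
  qed
  finally show ?thesis .
qed

text \<open>On the segment from \<gamma> to \<gamma>' the slope \<open>a\<close> drops at most at
  the rate \<open>\<kappa>\<^sup>2 * (norm (\<gamma>' - \<gamma>))\<^sup>2\<close>, and the path
  lemma halves this constant.\<close>

lemma ln_det_Omega_support:
  assumes Z: "Z \<in> carrier_mat n CARD('q)" and L: "sym_pos_def n \<Lambda>" and n: "0 < n"
    and \<gamma>: "\<forall>i. 0 \<le> vec_nth (\<gamma> :: real ^ 'q) i" and \<gamma>': "\<forall>i. 0 \<le> vec_nth \<gamma>' i"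
  shows "ln (Determinant.det (Omega Z \<Lambda> \<gamma>))
      + (\<Sum>j<CARD('q). vec_index (coords (\<gamma>' - \<gamma>)) j * gram Z \<Lambda> \<gamma> $$ (j, j))
      - ((sigma_max Z)\<^sup>2 / mu_min \<Lambda>)\<^sup>2 * (norm (\<gamma>' - \<gamma>))\<^sup>2 / 2
    \<le> ln (Determinant.det (Omega Z \<Lambda> \<gamma>'))"
proof -
  define \<kappa> where "\<kappa> = (sigma_max Z)\<^sup>2 / mu_min \<Lambda>"
  have \<kappa>: "0 \<le> \<kappa>" unfolding \<kappa>_def using mu_min_bound(1)[OF L n] by simp
  define d where "d j = vec_index (coords (\<gamma>' - \<gamma>)) j" for j
  define p where "p t = \<gamma> + t *\<^sub>R (\<gamma>' - \<gamma>)" for t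
  define G where "G t = gram Z \<Lambda> (p t)" for t
  define a where "a t = (\<Sum>j<CARD('q). d j * G t $$ (j, j))" for t
  have p0: "\<forall>i. 0 \<le> vec_nth (p t) i" if "0 \<le> t" "t \<le> 1" for t
  proof
    fix i
    have "vec_nth (p t) i = (1 - t) * vec_nth \<gamma> i + t * vec_nth \<gamma>' i"
      unfolding p_def by (simp add: algebra_simps)
    then show "0 \<le> vec_nth (p t) i" using that \<gamma> \<gamma>' by simp
  qed
  have dp: "vec_index (coords (p s - p t)) j = (s - t) * d j" if "j < CARD('q)" for s t j
    using that unfolding d_def p_def by (simp add: coords_index algebra_simps)
  have psd: "psd CARD('q) (G t)" if "0 \<le> t" "t \<le> 1" for t
    unfolding G_def by (rule gram_bounds(1)[OF Z L n p0[OF that]])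
  then have Gc: "G t \<in> carrier_mat CARD('q) CARD('q)" if "0 \<le> t" "t \<le> 1" for t
    using that unfolding psd_def by auto
  have row: "(\<Sum>k<CARD('q). (G t $$ (j, k))\<^sup>2) \<le> \<kappa>\<^sup>2" if "0 \<le> t" "t \<le> 1" "j < CARD('q)" for t j
    using psd_row_norm_le[OF psd[OF that(1,2)] that(3) \<kappa>] gram_bounds(2)[OF Z L n p0[OF that(1,2)]]
    unfolding G_def \<kappa>_def by blast
  have "ln (Determinant.det (Omega Z \<Lambda> (p 0))) + a 0 - \<kappa>\<^sup>2 * (norm (\<gamma>' - \<gamma>))\<^sup>2 / 2
      \<le> ln (Determinant.det (Omega Z \<Lambda> (p 1)))"
  proof (rule concave_path_lower_bound)
    fix s t :: real assume st: "0 \<le> s" "s \<le> 1" "0 \<le> t" "t \<le> 1"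
    have "(\<Sum>j<CARD('q). vec_index (coords (p s - p t)) j * gram Z \<Lambda> (p t) $$ (j, j)) = (s - t) * a t"
      unfolding a_def G_def sum_distrib_left by (intro sum.cong) (auto simp: dp)
    then show "ln (Determinant.det (Omega Z \<Lambda> (p s))) \<le> ln (Determinant.det (Omega Z \<Lambda> (p t))) + (s - t) * a t"
      using ln_det_Omega_tangent[OF Z L p0[OF st(3,4)] p0[OF st(1,2)]] by simp
  next
    fix t :: real assume t: "0 \<le> t" "t \<le> 1"
    let ?D = "Diag (p t - p 0)"
    have G0: "G 0 \<in> carrier_mat CARD('q) CARD('q)" and Gt: "G t \<in> carrier_mat CARD('q) CARD('q)"
      using Gc t by auto
    have res: "G 0 = G t + G 0 * ?D * G t"
      unfolding G_def using gram_resolvent[OF Z L p0 p0[OF t]] by simp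
    have entry: "G 0 $$ (j, j) - G t $$ (j, j) = (\<Sum>k<CARD('q). G 0 $$ (j, k) * (t * d k) * G t $$ (k, j))"
      if j: "j < CARD('q)" for j
    proof -
      have "G 0 * ?D = Matrix.mat CARD('q) CARD('q) (\<lambda>(i, k). G 0 $$ (i, k) * vec_index (coords (p t - p 0)) k)"
        unfolding Diag_def by (rule mat_diag_mult_right[OF G0])
      then have "(G 0 * ?D * G t) $$ (j, j) = (\<Sum>k<CARD('q). G 0 $$ (j, k) * (t * d k) * G t $$ (k, j))"
        using j Gt by (simp add: scalar_prod_def dp atLeast0LessThan)
      moreover have "G 0 $$ (j, j) = G t $$ (j, j) + (G 0 * ?D * G t) $$ (j, j)"
        using arg_cong[OF res, of "\<lambda>M. M $$ (j, j)"] j Gt G0 by (simp del: index_mult_mat(1))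
      ultimately show ?thesis by simp
    qed
    have "a 0 - a t = (\<Sum>j<CARD('q). d j * (G 0 $$ (j, j) - G t $$ (j, j)))"
      unfolding a_def by (simp add: sum_subtractf right_diff_distrib)
    \<comment> \<open>The resolvent identity leaves entries of \<open>gram\<close> at the two times
      0 and \<open>t\<close>; both matrices obey the same row bound, uniformly along the
      segment.\<close>
    also have "\<dots> = t * (\<Sum>j<CARD('q). \<Sum>k<CARD('q). d j * G 0 $$ (j, k) * d k * G t $$ (k, j))"
      by (simp add: entry sum_distrib_left mult_ac)
    also have "\<dots> \<le> t * (\<kappa>\<^sup>2 * (\<Sum>j<CARD('q). (d j)\<^sup>2))"
      using t row by (intro mult_left_mono bilinear_row_bound) auto
    also have "(\<Sum>j<CARD('q). (d j)\<^sup>2) = (norm (\<gamma>' - \<gamma>))\<^sup>2"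
      unfolding d_def by (rule sum_coords_square)
    finally show "a 0 - \<kappa>\<^sup>2 * (norm (\<gamma>' - \<gamma>))\<^sup>2 * t \<le> a t" by (simp add: mult_ac)
  qed
  then show ?thesis unfolding a_def G_def p_def d_def \<kappa>_def by simp
qed

text \<open>The quadratic term is the supremum over \<open>z\<close> of \<open>z \<bullet> r - z \<bullet> \<Omega> z / 2\<close>, which is affine
  in \<open>(r, \<Omega>)\<close>; the supremum is attained at \<open>z = \<Omega>\<^sup>-\<^sup>1 r\<close>.\<close>

lemma inv_form_variational:
  assumes A: "sym_pos_def n A" and r: "r \<in> carrier_vec n" and z: "z \<in> carrier_vec n"
  shows "scalar_prod z r - form A z z / 2 \<le> form (inv_mat A) r r / 2"
    and "z = inv_mat A *\<^sub>v r \<Longrightarrow> scalar_prod z r - form A z z / 2 = form (inv_mat A) r r / 2"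
proof -
  have Ac: "A \<in> carrier_mat n n" "transpose_mat A = A" using A unfolding sym_pos_def_def by auto
  note inv = sym_pos_def_inv[OF A]
  define w where "w = inv_mat A *\<^sub>v r"
  have w: "w \<in> carrier_vec n" unfolding w_def using inv r by auto
  have Aw: "A *\<^sub>v w = r" unfolding w_def
    using inv r Ac by (simp add: assoc_mult_mat_vec[symmetric, of _ n n _ n])
  have ww: "form A w w = form (inv_mat A) r r" unfolding Aw using r w by (simp add: w_def comm_scalar_prod[of _ n])
  have "0 \<le> form A (w + (- 1) \<cdot>\<^sub>v z) (w + (- 1) \<cdot>\<^sub>v z)"
    using sym_pos_def_imp_psd[OF A] w z unfolding psd_def by auto
  also have "\<dots> = form (inv_mat A) r r - 2 * scalar_prod z r + form A z z"
    unfolding form_add_smult[OF Ac w z] form_symmetric[OF Ac w z] ww unfolding Aw by simp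
  finally show "scalar_prod z r - form A z z / 2 \<le> form (inv_mat A) r r / 2" by simp
  have wr: "scalar_prod w r = form (inv_mat A) r r" using ww unfolding Aw .
  show "scalar_prod z r - form A z z / 2 = form (inv_mat A) r r / 2" if "z = inv_mat A *\<^sub>v r"
    unfolding that w_def[symmetric] Aw wr unfolding w_def by simp
qed

section \<open>The loss of one group\<close>

definition group_loss :: "real mat \<Rightarrow> real mat \<Rightarrow> real Matrix.vec \<Rightarrow> real mat \<Rightarrow> (real ^ 'p) \<times> (real ^ 'q) \<Rightarrow> real" where
  "group_loss X Z Y \<Lambda> w = form (inv_mat (Omega Z \<Lambda> (snd w))) (Y - X *\<^sub>v coords (fst w)) (Y - X *\<^sub>v coords (fst w)) / 2
     + ln (Determinant.det (Omega Z \<Lambda> (snd w))) / 2"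

lemma loss_eq_sum_group_loss:
  "loss m X Z Y \<Lambda> w = (\<Sum>i = 1..m. group_loss (X i) (Z i) (Y i) (\<Lambda> i) w)"
  unfolding loss_def group_loss_def by (simp add: case_prod_unfold Let_def)

text \<open>The maximizer \<open>z w\<close> of the variational formula at \<open>w\<close> is kept
  at every other point: equality holds at \<open>w\<close> and an inequality at \<open>y\<close>,
  and their difference is affine in the increment. The modulus is
  \<open>\<kappa>\<^sup>2 / 2\<close>, half of that of \<open>ln det\<close>.\<close>

lemma group_loss_weakly_supported:
  assumes X: "X \<in> carrier_mat n CARD('p)" and Z: "Z \<in> carrier_mat n CARD('q)"
    and Y: "Y \<in> carrier_vec n" and L: "sym_pos_def n \<Lambda>" and n: "0 < n"
  shows "weakly_supported {w :: (real ^ 'p) \<times> (real ^ 'q). \<forall>i. 0 \<le> vec_nth (snd w) i}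
    (1 / 2 * mu_min \<Lambda> powi (- 2) * (sigma_max Z) ^ 4) (group_loss X Z Y \<Lambda>)"
proof -
  define res where "res w = Y - X *\<^sub>v coords (fst w)" for w :: "(real ^ 'p) \<times> (real ^ 'q)"
  define z where "z w = inv_mat (Omega Z \<Lambda> (snd w)) *\<^sub>v res w" for w
  define u where "u w j = (vec_index (transpose_mat Z *\<^sub>v z w) j)\<^sup>2" for w j
  define \<kappa> where "\<kappa> = (sigma_max Z)\<^sup>2 / mu_min \<Lambda>"
  \<comment> \<open>Formally the gradient of the group loss: \<open>- X^T z\<close> in \<beta>, and
    in \<gamma> half of the slope of \<open>ln det\<close> minus the squared entries of
    \<open>Z^T z\<close>.\<close>
  define l where "l w = (\<lambda>h :: (real ^ 'p) \<times> (real ^ 'q). - scalar_prod (z w) (X *\<^sub>v coords (fst h))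
      + (\<Sum>j<CARD('q). vec_index (coords (snd h)) j * ((gram Z \<Lambda> (snd w) $$ (j, j) - u w j) / 2)))"
    for w :: "(real ^ 'p) \<times> (real ^ 'q)"
  have Lc: "\<Lambda> \<in> carrier_mat n n" using L unfolding sym_pos_def_def by auto
  have res: "res w \<in> carrier_vec n" for w unfolding res_def using X Y by auto
  have const: "1 / 2 * mu_min \<Lambda> powi (- 2) * (sigma_max Z) ^ 4 = \<kappa>\<^sup>2 / 2"
    unfolding \<kappa>_def using mu_min_bound(1)[OF L n]
    by (simp add: power_int_minus power_divide power_mult[symmetric] field_simps)
  show ?thesis
    unfolding const
  proof (rule weakly_supportedI[where l = l])
    fix w :: "(real ^ 'p) \<times> (real ^ 'q)" assume "w \<in> {w. \<forall>i. 0 \<le> vec_nth (snd w) i}"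
    then have w: "\<forall>i. 0 \<le> vec_nth (snd w) i" by simp
    note spd = Omega_sym_pos_def[OF Z L w]
    have zc: "z w \<in> carrier_vec n" unfolding z_def using sym_pos_def_inv(1)[OF spd] res by auto
    note lin = linear_scalar_prod_coords[OF X zc]
      linear_sum_coords[of "\<lambda>j. (gram Z \<Lambda> (snd w) $$ (j, j) - u w j) / 2"]
    have "linear (\<lambda>h :: (real ^ 'p) \<times> (real ^ 'q). scalar_prod (z w) (X *\<^sub>v coords (fst h)))"
      using linear_compose[OF linear_fst lin(1)] by (simp add: o_def)
    moreover have "linear (\<lambda>h :: (real ^ 'p) \<times> (real ^ 'q).
        \<Sum>j<CARD('q). vec_index (coords (snd h)) j * ((gram Z \<Lambda> (snd w) $$ (j, j) - u w j) / 2))"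
      using linear_compose[OF linear_snd lin(2)] by (simp add: o_def)
    ultimately show "linear (l w)"
      unfolding l_def by (intro linear_compose_add linear_compose_neg)
    fix y :: "(real ^ 'p) \<times> (real ^ 'q)" assume "y \<in> {w. \<forall>i. 0 \<le> vec_nth (snd w) i}"
    then have y: "\<forall>i. 0 \<le> vec_nth (snd y) i" by simp
    note spd' = Omega_sym_pos_def[OF Z L y]
    have "form (Omega Z \<Lambda> (snd y)) (z w) (z w) - form (Omega Z \<Lambda> (snd w)) (z w) (z w)
        = (\<Sum>j<CARD('q). vec_index (coords (snd (y - w))) j * u w j)"
      unfolding Omega_form[OF Z Lc zc] u_def
      by (simp add: sum_subtractf[symmetric] coords_index left_diff_distrib)
    moreover have "scalar_prod (z w) (res y) - scalar_prod (z w) (res w)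
        = - scalar_prod (z w) (X *\<^sub>v coords (fst (y - w)))"
    proof -
      have Xc: "X *\<^sub>v coords b \<in> carrier_vec n" for b :: "real ^ 'p" using X by auto
      have "scalar_prod (z w) (res v) = scalar_prod (z w) Y - scalar_prod (z w) (X *\<^sub>v coords (fst v))" for v
        unfolding res_def by (rule scalar_prod_minus_distrib[OF zc Y Xc])
      then show ?thesis using linear_diff[OF lin(1)] by simp
    qed
    moreover have "form (inv_mat (Omega Z \<Lambda> (snd w))) (res w) (res w) / 2
        = scalar_prod (z w) (res w) - form (Omega Z \<Lambda> (snd w)) (z w) (z w) / 2"
      using inv_form_variational(2)[OF spd res zc] unfolding z_def by simp
    moreover have "scalar_prod (z w) (res y) - form (Omega Z \<Lambda> (snd y)) (z w) (z w) / 2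
        \<le> form (inv_mat (Omega Z \<Lambda> (snd y))) (res y) (res y) / 2"
      by (rule inv_form_variational(1)[OF spd' res zc])
    moreover have "ln (Determinant.det (Omega Z \<Lambda> (snd w)))
        + (\<Sum>j<CARD('q). vec_index (coords (snd (y - w))) j * gram Z \<Lambda> (snd w) $$ (j, j))
        - \<kappa>\<^sup>2 * (norm (snd (y - w)))\<^sup>2 / 2 \<le> ln (Determinant.det (Omega Z \<Lambda> (snd y)))"
      using ln_det_Omega_support[OF Z L n w y] unfolding \<kappa>_def by simp
    moreover have "\<kappa>\<^sup>2 * (norm (snd (y - w)))\<^sup>2 \<le> \<kappa>\<^sup>2 * (norm (y - w))\<^sup>2"
      using norm_snd_le[of "snd (y - w)" "fst (y - w)"] unfolding prod.collapse
      by (intro mult_left_mono power_mono) auto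
    moreover have "l w (y - w) = - scalar_prod (z w) (X *\<^sub>v coords (fst (y - w)))
        + ((\<Sum>j<CARD('q). vec_index (coords (snd (y - w))) j * gram Z \<Lambda> (snd w) $$ (j, j))
          - (\<Sum>j<CARD('q). vec_index (coords (snd (y - w))) j * u w j)) / 2"
      unfolding l_def sum_subtractf[symmetric] sum_divide_distrib by (simp add: right_diff_distrib)
    ultimately show "group_loss X Z Y \<Lambda> w + l w (y - w) - \<kappa>\<^sup>2 / 2 / 2 * (norm (y - w))\<^sup>2
        \<le> group_loss X Z Y \<Lambda> y"
      unfolding group_loss_def res_def[symmetric] by argo
  qed
qed

section \<open>The barrier and the envelope\<close>

text \<open>Real-valued counterpart of \<open>barrier\<close> on the feasible set. For \<mu> = 0 the
  factor in front makes it vanish, so both kinds of penalty share one formula.\<close>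

definition log_barrier :: "real \<Rightarrow> real ^ 'q \<Rightarrow> real" where
  "log_barrier \<mu> \<gamma> = - \<mu> * (\<Sum>i\<in>UNIV. ln (vec_nth \<gamma> i / \<mu>))"

lemma feasible_iff:
  assumes "0 \<le> \<mu>"
  shows "w \<in> feasible \<mu> \<longleftrightarrow> (\<forall>i. if \<mu> = 0 then 0 \<le> vec_nth (snd w) i else 0 < vec_nth (snd w) i)"
  unfolding feasible_def effective_domain_def barrier_def mem_Times_iff by auto

lemma barrier_feasible: "0 \<le> \<mu> \<Longrightarrow> w \<in> feasible \<mu> \<Longrightarrow> barrier \<mu> (snd w) = ereal (log_barrier \<mu> (snd w))"
  unfolding feasible_iff barrier_def log_barrier_def by auto

lemma feasible_nonneg: "0 \<le> \<mu> \<Longrightarrow> w \<in> feasible \<mu> \<Longrightarrow> 0 \<le> vec_nth (snd w) i"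
  unfolding feasible_iff by (auto split: if_splits simp: less_imp_le)

lemma convex_feasible:
  assumes "0 \<le> \<mu>"
  shows "convex (feasible \<mu> :: ((real ^ 'p) \<times> (real ^ 'q)) set)"
proof (cases "\<mu> = 0")
  case True
  then show ?thesis unfolding convex_def by (auto simp: feasible_iff)
next
  case False
  show ?thesis
  proof (rule convexI)
    fix x y :: "(real ^ 'p) \<times> (real ^ 'q)" and s t :: real
    assume h: "x \<in> feasible \<mu>" "y \<in> feasible \<mu>" "0 \<le> s" "0 \<le> t" "s + t = 1"
    have "0 < s * vec_nth (snd x) i + t * vec_nth (snd y) i" for i
    proof -
      have "0 < vec_nth (snd x) i" "0 < vec_nth (snd y) i"
        using h(1,2) False assms by (auto simp: feasible_iff)
      then show ?thesis using h(3-5)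
        by (cases "s = 0") (auto intro: add_pos_nonneg)
    qed
    then show "s *\<^sub>R x + t *\<^sub>R y \<in> feasible \<mu>" using False assms by (simp add: feasible_iff)
  qed
qed

text \<open>The bound \<open>ln a \<le> a - 1\<close> is used at the ratio of components, where the
  scaling by \<mu> cancels. For \<mu> = 0 the leading factor makes the support zero even if a
  component of \<open>x\<close> vanishes.\<close>

lemma log_barrier_weakly_supported:
  assumes "0 \<le> \<mu>"
  shows "weakly_supported (feasible \<mu> :: ((real ^ 'p) \<times> (real ^ 'q)) set) 0 (\<lambda>w. log_barrier \<mu> (snd w))"
proof (rule weakly_supportedI[where l = "\<lambda>w h. - \<mu> * (\<Sum>i\<in>UNIV. vec_nth (snd h) i / vec_nth (snd w) i)"])
  fix x :: "(real ^ 'p) \<times> (real ^ 'q)" assume x: "x \<in> feasible \<mu>"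
  show "linear (\<lambda>h :: (real ^ 'p) \<times> (real ^ 'q). - \<mu> * (\<Sum>i\<in>UNIV. vec_nth (snd h) i / vec_nth (snd x) i))"
    by (rule linearI) (simp_all add: add_divide_distrib sum.distrib distrib_left sum_distrib_left mult_ac)
  fix y :: "(real ^ 'p) \<times> (real ^ 'q)" assume y: "y \<in> feasible \<mu>"
  show "log_barrier \<mu> (snd x) + - \<mu> * (\<Sum>i\<in>UNIV. vec_nth (snd (y - x)) i / vec_nth (snd x) i)
      - 0 / 2 * (norm (y - x))\<^sup>2 \<le> log_barrier \<mu> (snd y)"
  proof (cases "\<mu> = 0")
    case False
    then have \<mu>: "0 < \<mu>" using assms by simp
    have "ln (vec_nth (snd y) i / \<mu>) \<le> ln (vec_nth (snd x) i / \<mu>) + vec_nth (snd (y - x)) i / vec_nth (snd x) i" for i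
    proof -
      have p: "0 < vec_nth (snd x) i" "0 < vec_nth (snd y) i"
        using x y \<mu> by (auto simp: feasible_iff)
      have "ln (vec_nth (snd y) i / vec_nth (snd x) i) \<le> vec_nth (snd y) i / vec_nth (snd x) i - 1"
        using p by (intro ln_le_minus_one) simp
      then show ?thesis using p \<mu> by (simp add: ln_divide_pos diff_divide_distrib)
    qed
    then have "(\<Sum>i\<in>UNIV. ln (vec_nth (snd y) i / \<mu>))
        \<le> (\<Sum>i\<in>UNIV. ln (vec_nth (snd x) i / \<mu>)) + (\<Sum>i\<in>UNIV. vec_nth (snd (y - x)) i / vec_nth (snd x) i)"
      unfolding sum.distrib[symmetric] by (intro sum_mono)
    then have "\<mu> * (\<Sum>i\<in>UNIV. ln (vec_nth (snd y) i / \<mu>))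
        \<le> \<mu> * ((\<Sum>i\<in>UNIV. ln (vec_nth (snd x) i / \<mu>)) + (\<Sum>i\<in>UNIV. vec_nth (snd (y - x)) i / vec_nth (snd x) i))"
      using \<mu> by (intro mult_left_mono) auto
    then show ?thesis unfolding log_barrier_def by (simp add: distrib_left)
  qed (simp add: log_barrier_def)
qed

lemma log_barrier_bounded_imp_component_ge:
  assumes \<mu>: "0 < \<mu>" and M: "0 \<le> M"
  obtains \<epsilon> where "0 < \<epsilon>" "\<And>\<gamma> :: real ^ 'q. \<lbrakk>\<forall>i. 0 < vec_nth \<gamma> i; norm \<gamma> \<le> M; log_barrier \<mu> \<gamma> \<le> r\<rbrakk> \<Longrightarrow> \<epsilon> \<le> vec_nth \<gamma> j"
proof -
  \<comment> \<open>On the ball each logarithm other than the one at \<open>j\<close> is at most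
    \<open>M / \<mu>\<close>; solving the bound \<open>r\<close> on the barrier for the remaining
    logarithm gives this value.\<close>
  define \<epsilon> where "\<epsilon> = \<mu> * exp (- (r / \<mu> + real CARD('q) * (M / \<mu>)))"
  have "\<epsilon> \<le> vec_nth \<gamma> j" if pos: "\<forall>i. 0 < vec_nth \<gamma> i" and n: "norm \<gamma> \<le> M" and b: "log_barrier \<mu> \<gamma> \<le> r"
    for \<gamma> :: "real ^ 'q"
  proof -
    have "(\<Sum>i\<in>UNIV - {j}. ln (vec_nth \<gamma> i / \<mu>)) \<le> (\<Sum>i\<in>UNIV - {j}. M / \<mu>)"
    proof (intro sum_mono)
      fix i
      have "ln (vec_nth \<gamma> i / \<mu>) \<le> vec_nth \<gamma> i / \<mu> - 1"
        using pos \<mu> by (intro ln_le_minus_one) simp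
      also have "\<dots> \<le> vec_nth \<gamma> i / \<mu>" by simp
      also have "\<dots> \<le> M / \<mu>"
        using component_le_norm_cart[of \<gamma> i] n \<mu> by (intro divide_right_mono) auto
      finally show "ln (vec_nth \<gamma> i / \<mu>) \<le> M / \<mu>" .
    qed
    also have "\<dots> = real (card (UNIV - {j} :: 'q set)) * (M / \<mu>)" by simp
    also have "\<dots> \<le> real CARD('q) * (M / \<mu>)"
      using M \<mu> by (intro mult_right_mono) (auto intro: card_mono)
    finally have "(\<Sum>i\<in>UNIV. ln (vec_nth \<gamma> i / \<mu>)) \<le> ln (vec_nth \<gamma> j / \<mu>) + real CARD('q) * (M / \<mu>)"
      by (simp add: sum.remove[of UNIV j])
    moreover have "- (r / \<mu>) \<le> (\<Sum>i\<in>UNIV. ln (vec_nth \<gamma> i / \<mu>))"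
      using b \<mu> unfolding log_barrier_def by (simp add: field_simps)
    ultimately have "- (r / \<mu> + real CARD('q) * (M / \<mu>)) \<le> ln (vec_nth \<gamma> j / \<mu>)" by linarith
    then have "exp (- (r / \<mu> + real CARD('q) * (M / \<mu>))) \<le> vec_nth \<gamma> j / \<mu>"
      using pos \<mu> by (subst (asm) exp_le_cancel_iff[symmetric]) simp
    then show ?thesis unfolding \<epsilon>_def using \<mu> by (simp add: field_simps)
  qed
  moreover have "0 < \<epsilon>" unfolding \<epsilon>_def using \<mu> by simp
  ultimately show ?thesis using that by blast
qed

text \<open>The issue for \<mu> > 0 is that a limit must stay strictly positive. A convergent
  sequence is bounded, so \<open>L\<close> is bounded below along it; the sublevel condition then
  bounds the barrier from above and each component away from 0.\<close>

lemma barrier_sublevel_closed: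
  fixes L :: "(real ^ 'p) \<times> (real ^ 'q) \<Rightarrow> real"
  assumes \<mu>: "0 \<le> \<mu>" and L: "weakly_supported (feasible \<mu>) c L" and c: "0 \<le> c" and \<eta>: "0 \<le> \<eta>"
  shows "closed {w \<in> feasible \<mu>. L w + log_barrier \<mu> (snd w) + \<eta> / 2 * (norm (w - w'))\<^sup>2 \<le> r}"
  unfolding closed_sequential_limits
proof (intro allI impI)
  fix W and w :: "(real ^ 'p) \<times> (real ^ 'q)"
  let ?g = "\<lambda>w. L w + log_barrier \<mu> (snd w) + \<eta> / 2 * (norm (w - w'))\<^sup>2"
  assume W: "(\<forall>k. W k \<in> {w \<in> feasible \<mu>. ?g w \<le> r}) \<and> W \<longlonglongrightarrow> w"
  then have Wf: "\<And>k. W k \<in> feasible \<mu>" and Wr: "\<And>k. ?g (W k) \<le> r" and lim: "W \<longlonglongrightarrow> w" by auto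
  have snd_lim: "(\<lambda>k. vec_nth (snd (W k)) i) \<longlonglongrightarrow> vec_nth (snd w) i" for i
    by (intro tendsto_intros lim)
  have w: "w \<in> feasible \<mu>"
  proof (cases "\<mu> = 0")
    case True
    have "0 \<le> vec_nth (snd w) i" for i
      by (rule LIMSEQ_le_const[OF snd_lim]) (use feasible_nonneg[OF \<mu> Wf] in auto)
    then show ?thesis using True by (simp add: feasible_iff)
  next
    case False
    then have pos: "0 < \<mu>" using \<mu> by simp
    have bdd: "bounded (range W)" using convergent_imp_bounded[OF lim] .
    obtain b where b: "\<And>y. y \<in> feasible \<mu> \<Longrightarrow> y \<in> range W \<Longrightarrow> b \<le> L y"
      using weakly_supported_bounded_below[OF L _ bdd c] Wf by blast
    obtain M where M: "0 < M" "\<And>y. y \<in> range W \<Longrightarrow> norm y \<le> M"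
      using bdd unfolding bounded_pos by blast
    have nonneg: "0 \<le> \<eta> / 2 * (norm (W k - w'))\<^sup>2" for k using \<eta> by simp
    have "log_barrier \<mu> (snd (W k)) \<le> r - b" for k
      using Wr[of k] b[OF Wf, of k] nonneg[of k] by auto
    moreover have "norm (snd (W k)) \<le> M" for k
      using M(2)[of "W k"] norm_snd_le[of "snd (W k)" "fst (W k)"] by simp
    moreover have "\<forall>i. 0 < vec_nth (snd (W k)) i" for k
      using Wf[of k] pos by (simp add: feasible_iff)
    ultimately have "0 < vec_nth (snd w) i" for i
    proof -
      obtain \<epsilon> where \<epsilon>: "0 < \<epsilon>" "\<And>\<gamma> :: real ^ 'q. \<lbrakk>\<forall>i. 0 < vec_nth \<gamma> i; norm \<gamma> \<le> M; log_barrier \<mu> \<gamma> \<le> r - b\<rbrakk> \<Longrightarrow> \<epsilon> \<le> vec_nth \<gamma> i"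
        using log_barrier_bounded_imp_component_ge[OF pos less_imp_le[OF M(1)], where r = "r - b" and j = i] by blast
      have "\<epsilon> \<le> vec_nth (snd w) i"
        by (rule LIMSEQ_le_const[OF snd_lim])
          (use \<epsilon>(2) \<open>\<And>k. log_barrier \<mu> (snd (W k)) \<le> r - b\<close> \<open>\<And>k. norm (snd (W k)) \<le> M\<close>
            \<open>\<And>k. \<forall>i. 0 < vec_nth (snd (W k)) i\<close> in blast)
      then show ?thesis using \<epsilon>(1) by simp
    qed
    then show ?thesis using pos by (simp add: feasible_iff)
  qed
  have supp: "weakly_supported (feasible \<mu>) (c + 0 - \<eta>) ?g"
    by (intro weakly_supported_proximal weakly_supported_add L log_barrier_weakly_supported \<mu>)
  have "?g w \<le> r"
    by (rule weakly_supported_limit_le[OF supp, of w W r]) (fact w Wf lim Wr)+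
  with w show "w \<in> {w \<in> feasible \<mu>. ?g w \<le> r}" by blast
qed

section \<open>The proximal objective and its envelope\<close>

lemma norm_prod_square: "(norm w)\<^sup>2 = (norm (fst w))\<^sup>2 + (norm (snd w))\<^sup>2"
  for w :: "'a::real_normed_vector \<times> 'b::real_normed_vector"
  unfolding norm_prod_def by simp

lemma penalized_loss_feasible:
  assumes "0 \<le> \<mu>" "w \<in> feasible \<mu>"
  shows "penalized_loss m X Z Y \<Lambda> \<eta> \<mu> w w'
    = ereal (loss m X Z Y \<Lambda> w + log_barrier \<mu> (snd w) + \<eta> / 2 * (norm (w - w'))\<^sup>2)"
  using barrier_feasible[OF assms]
  unfolding penalized_loss_def norm_prod_square by (simp add: case_prod_unfold)

text \<open>The group moduli add up, and their sum is at most the number of groups times the largest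
  one, which is the form of \<open>eta_bar\<close>.\<close>

lemma loss_weakly_supported:
  assumes "\<And>i. i \<in> {1..m} \<Longrightarrow> 1 \<le> n i"
    and "\<And>i. i \<in> {1..m} \<Longrightarrow> X i \<in> carrier_mat (n i) CARD('p)"
    and "\<And>i. i \<in> {1..m} \<Longrightarrow> Z i \<in> carrier_mat (n i) CARD('q)"
    and "\<And>i. i \<in> {1..m} \<Longrightarrow> Y i \<in> carrier_vec (n i)"
    and "\<And>i. i \<in> {1..m} \<Longrightarrow> sym_pos_def (n i) (\<Lambda> i)"
  shows "weakly_supported {w :: (real ^ 'p) \<times> (real ^ 'q). \<forall>i. 0 \<le> vec_nth (snd w) i}
    (eta_bar m Z \<Lambda>) (loss m X Z Y \<Lambda>)"
proof -
  let ?c = "\<lambda>i. 1 / 2 * mu_min (\<Lambda> i) powi (- 2) * sigma_max (Z i) ^ 4"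
  have "weakly_supported {w :: (real ^ 'p) \<times> (real ^ 'q). \<forall>i. 0 \<le> vec_nth (snd w) i}
      (\<Sum>i = 1..m. ?c i) (\<lambda>w. \<Sum>i = 1..m. group_loss (X i) (Z i) (Y i) (\<Lambda> i) w)"
  proof (rule weakly_supported_sum)
    fix i assume i: "i \<in> {1..m}"
    then have "0 < n i" using assms(1) by fastforce
    then show "weakly_supported {w :: (real ^ 'p) \<times> (real ^ 'q). \<forall>i. 0 \<le> vec_nth (snd w) i} (?c i)
        (group_loss (X i) (Z i) (Y i) (\<Lambda> i))"
      using assms(2-5)[OF i] by (intro group_loss_weakly_supported)
  qed simp
  moreover have "(\<Sum>i = 1..m. ?c i) \<le> eta_bar m Z \<Lambda>"
  proof -
    have "?c i \<le> (MAX i\<in>{1..m}. ?c i)" if "i \<in> {1..m}" for i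
      using that by (intro Max_ge) auto
    then have "(\<Sum>i = 1..m. ?c i) \<le> real (card {1..m}) * (MAX i\<in>{1..m}. ?c i)"
      by (rule sum_bounded_above)
    then show ?thesis unfolding eta_bar_def by simp
  qed
  ultimately have "weakly_supported {w :: (real ^ 'p) \<times> (real ^ 'q). \<forall>i. 0 \<le> vec_nth (snd w) i}
      (eta_bar m Z \<Lambda>) (\<lambda>w. \<Sum>i = 1..m. group_loss (X i) (Z i) (Y i) (\<Lambda> i) w)"
    by (rule weakly_supported_mono)
  moreover have "loss m X Z Y \<Lambda> = (\<lambda>w :: (real ^ 'p) \<times> (real ^ 'q). \<Sum>i = 1..m. group_loss (X i) (Z i) (Y i) (\<Lambda> i) w)"
    by (rule ext) (rule loss_eq_sum_group_loss)
  ultimately show ?thesis by simp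
qed

lemma eta_bar_nonneg:
  assumes "1 \<le> m"
  shows "0 \<le> eta_bar m Z \<Lambda>"
proof -
  let ?c = "\<lambda>i. 1 / 2 * mu_min (\<Lambda> i) powi (- 2) * sigma_max (Z i) ^ 4"
  have "0 \<le> ?c 1" by (simp add: power_int_minus)
  also have "\<dots> \<le> (MAX i\<in>{1..m}. ?c i)" using assms by (intro Max_ge) auto
  finally show ?thesis unfolding eta_bar_def by simp
qed

theorem theorem10:
  fixes m :: nat and n :: "nat \<Rightarrow> nat"
    and X Z \<Lambda> :: "nat \<Rightarrow> real mat" and Y :: "nat \<Rightarrow> real Matrix.vec"
    and \<mu> \<eta> :: real
    and R :: "(real ^ 'p) \<times> (real ^ 'q) \<Rightarrow> ereal"
  assumes "1 \<le> m"
    and "\<And>i. i \<in> {1..m} \<Longrightarrow> 1 \<le> n i"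
    and "\<And>i. i \<in> {1..m} \<Longrightarrow> X i \<in> carrier_mat (n i) CARD('p)"
    and "\<And>i. i \<in> {1..m} \<Longrightarrow> Z i \<in> carrier_mat (n i) CARD('q)"
    and "\<And>i. i \<in> {1..m} \<Longrightarrow> Y i \<in> carrier_vec (n i)"
    and "\<And>i. i \<in> {1..m} \<Longrightarrow> sym_pos_def (n i) (\<Lambda> i)"
    and "0 \<le> \<mu>"
    and "eta_bar m Z \<Lambda> < \<eta>"
    and "\<And>w. 0 \<le> R w"
    and "lower_semicontinuous R"
    and "\<mu> = 0 \<Longrightarrow> level_compact R"
    and "0 < \<mu> \<Longrightarrow> one_coercive R"
  defines "F \<equiv> (penalized_loss m X Z Y \<Lambda> \<eta> \<mu>
                 :: (real ^ 'p) \<times> (real ^ 'q) \<Rightarrow> (real ^ 'p) \<times> (real ^ 'q) \<Rightarrow> ereal)"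
    and "S \<equiv> (solution_map m X Z Y \<Lambda> \<eta> \<mu>
                 :: (real ^ 'p) \<times> (real ^ 'q) \<Rightarrow> (real ^ 'p) \<times> (real ^ 'q))"
    and "u \<equiv> (value_fun m X Z Y \<Lambda> \<eta> \<mu> :: (real ^ 'p) \<times> (real ^ 'q) \<Rightarrow> ereal)"
  shows "(\<forall>w'. (\<exists>!w. is_arg_min (\<lambda>w. F w w') (\<lambda>w. w \<in> feasible \<mu>) w) \<and>
               is_arg_min (\<lambda>w. F w w') (\<lambda>w. w \<in> feasible \<mu>) (S w') \<and>
               u w' = F (S w') w' \<and> \<bar>u w'\<bar> \<noteq> \<infinity>) \<and>
         (\<forall>w'. GDERIV (\<lambda>w. real_of_ereal (u w)) w' :>
                 \<eta> *\<^sub>R (fst w' - fst (S w'), snd w' - snd (S w'))) \<and>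
         continuous_on UNIV (\<lambda>w'. \<eta> *\<^sub>R (fst w' - fst (S w'), snd w' - snd (S w')))"
proof -
  define C where "C = (feasible \<mu> :: ((real ^ 'p) \<times> (real ^ 'q)) set)"
  define f where "f w = loss m X Z Y \<Lambda> w + log_barrier \<mu> (snd w)" for w :: "(real ^ 'p) \<times> (real ^ 'q)"
  define \<kappa> where "\<kappa> = \<eta> - eta_bar m Z \<Lambda>"
  have \<kappa>: "0 < \<kappa>" and \<eta>: "0 \<le> \<eta>" and bar: "0 \<le> eta_bar m Z \<Lambda>"
    using assms(8) eta_bar_nonneg[OF assms(1), of Z \<Lambda>] unfolding \<kappa>_def by auto
  have L: "weakly_supported C (eta_bar m Z \<Lambda>) (loss m X Z Y \<Lambda>)"
    by (rule weakly_supported_subset[OF loss_weakly_supported[OF assms(2-6)]])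
      (use feasible_nonneg[OF assms(7)] in \<open>auto simp: C_def\<close>)
  have B: "weakly_supported C 0 (\<lambda>w. log_barrier \<mu> (snd w))"
    unfolding C_def by (rule log_barrier_weakly_supported[OF assms(7)])
  have supp: "weakly_supported C (- \<kappa>) (\<lambda>w. f w + \<eta> / 2 * (norm (w - w'))\<^sup>2)" for w'
    using weakly_supported_proximal[OF weakly_supported_add[OF L B], of \<eta> w']
    unfolding f_def \<kappa>_def by simp
  have conv: "convex C" unfolding C_def by (rule convex_feasible[OF assms(7)])
  \<comment> \<open>All components are strictly positive, so the point is feasible for \<mu> = 0 and
    \<mu> > 0 alike.\<close>
  have "(0, \<chi> i. 1) \<in> C" unfolding C_def by (simp add: feasible_iff[OF assms(7)])
  then have ne: "C \<noteq> {}" by auto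
  have clo: "closed {w \<in> C. f w + \<eta> / 2 * (norm (w - w'))\<^sup>2 \<le> r}" for w' r
    unfolding f_def C_def by (rule barrier_sublevel_closed[OF assms(7) L[unfolded C_def] bar \<eta>])
  have F: "F w w' = ereal (f w + \<eta> / 2 * (norm (w - w'))\<^sup>2)" if "w \<in> C" for w w'
    unfolding F_def f_def using penalized_loss_feasible[OF assms(7)] that C_def by blast
  \<comment> \<open>Stated for an arbitrary minimizer: two of them compared with each other give
    uniqueness, and the chosen ones give the Lipschitz bound.\<close>
  have growth: "f w + \<eta> / 2 * (norm (w - w'))\<^sup>2 + \<kappa> / 2 * (norm (y - w))\<^sup>2 \<le> f y + \<eta> / 2 * (norm (y - w'))\<^sup>2"
    if min: "is_arg_min (\<lambda>w. F w w') (\<lambda>w. w \<in> feasible \<mu>) w" and y: "y \<in> C" for w w' y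
  proof (rule strongly_supported_minimizer_growth[OF supp conv _ y])
    show w: "w \<in> C" using min unfolding is_arg_min_def C_def by blast
    show "f w + \<eta> / 2 * (norm (w - w'))\<^sup>2 \<le> f z + \<eta> / 2 * (norm (z - w'))\<^sup>2" if z: "z \<in> C" for z
    proof -
      have "F w w' \<le> F z w'" using min z unfolding is_arg_min_linorder C_def by blast
      then show ?thesis unfolding F[OF z] F[OF w] by simp
    qed
  qed
  have ex: "\<exists>w. is_arg_min (\<lambda>w. F w w') (\<lambda>w. w \<in> feasible \<mu>) w" for w'
  proof -
    obtain x where x: "x \<in> C"
      "\<And>y. y \<in> C \<Longrightarrow> f x + \<eta> / 2 * (norm (x - w'))\<^sup>2 \<le> f y + \<eta> / 2 * (norm (y - w'))\<^sup>2"
      using strongly_supported_minimizer_exists[OF supp \<kappa> ne clo] by blast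
    have "is_arg_min (\<lambda>w. F w w') (\<lambda>w. w \<in> feasible \<mu>) x"
      unfolding is_arg_min_linorder using x F by (simp add: C_def)
    then show ?thesis by blast
  qed
  have unique: "w = v" if "is_arg_min (\<lambda>w. F w w') (\<lambda>w. w \<in> feasible \<mu>) w"
    "is_arg_min (\<lambda>w. F w w') (\<lambda>w. w \<in> feasible \<mu>) v" for w v w'
  proof -
    have c: "w \<in> C" "v \<in> C" using that unfolding is_arg_min_def C_def by auto
    have "\<kappa> * (norm (v - w))\<^sup>2 \<le> 0"
      using growth[OF that(1) c(2)] growth[OF that(2) c(1)] by (simp add: norm_minus_commute)
    then show ?thesis using \<kappa> by (simp add: mult_le_0_iff)
  qed
  \<comment> \<open>\<open>solution_map\<close> unfolds to a Hilbert choice, which existence of a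
    minimizer turns into an actual one.\<close>
  have S: "is_arg_min (\<lambda>w. F w w') (\<lambda>w. w \<in> feasible \<mu>) (S w')" for w'
    unfolding S_def solution_map_def arg_min_on_def arg_min_def F_def[symmetric]
    by (rule someI_ex[OF ex])
  have SC: "S w' \<in> C" for w' using S[of w'] unfolding is_arg_min_def C_def by blast
  have u: "u w' = F (S w') w'" for w'
    unfolding u_def value_fun_def F_def[symmetric]
  proof (rule antisym)
    show "(INF w\<in>feasible \<mu>. F w w') \<le> F (S w') w'" using SC unfolding C_def by (intro INF_lower) auto
    show "F (S w') w' \<le> (INF w\<in>feasible \<mu>. F w w')"
      using S[of w'] unfolding is_arg_min_linorder by (intro INF_greatest) auto
  qed
  have lip: "norm (S a - S b) \<le> \<eta> / \<kappa> * norm (a - b)" for a b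
    by (rule proximal_map_lipschitz[where S = S and C = C and f = f, OF SC growth[OF S] \<kappa> \<eta>])
  have min: "f (S w') + \<eta> / 2 * (norm (S w' - w'))\<^sup>2 \<le> f y + \<eta> / 2 * (norm (y - w'))\<^sup>2" if "y \<in> C" for w' y
  proof -
    have "0 \<le> \<kappa> / 2 * (norm (y - S w'))\<^sup>2" using \<kappa> by simp
    then show ?thesis using growth[OF S that, of w'] by linarith
  qed
  have pair: "(fst w' - fst (S w'), snd w' - snd (S w')) = w' - S w'" for w'
    by (simp add: prod_eq_iff)
  have "real_of_ereal (u w) = f (S w) + \<eta> / 2 * (norm (S w - w))\<^sup>2" for w
    unfolding u F[OF SC] by simp
  then have grad: "GDERIV (\<lambda>w. real_of_ereal (u w)) w' :> \<eta> *\<^sub>R (w' - S w')" for w'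
    using envelope_gradient[where S = S and C = C and f = f, OF SC min lip \<eta>] \<eta> \<kappa> by simp
  have "continuous_on UNIV S"
  proof (rule lipschitz_on_continuous_on)
    show "(\<eta> / \<kappa>)-lipschitz_on UNIV S"
      using lip \<eta> \<kappa> by (intro lipschitz_onI) (auto simp: dist_norm)
  qed
  then have cont: "continuous_on UNIV (\<lambda>w'. \<eta> *\<^sub>R (w' - S w'))"
    by (intro continuous_intros)
  have unique_ex: "\<exists>!w. is_arg_min (\<lambda>w. F w w') (\<lambda>w. w \<in> feasible \<mu>) w" for w'
    using ex[of w'] unique[of w'] by blast
  have finite: "\<bar>u w'\<bar> \<noteq> \<infinity>" for w' unfolding u F[OF SC] by simp
  show ?thesis
    unfolding pair by (intro conjI allI unique_ex S u finite grad cont)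
qed

end
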